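(* Let $x_1, x_2, \ldots, x_n$ be weakly fully independent self-adjoint random variables in $\mathfrak{M}$ such that $s_k s_n = s_n s_k$ for $k=1,2,\ldots,n$, where $s_k = x_1+\cdots+x_k$ are the partial sums. Then for each $\lambda>0$, setting $$M_{\lambda} := \frac{1}{\min\limits_{1 \leq k\leq n} \tau\left(e_{(-\infty, \frac{\lambda}{2}]}\left(|s_n - s_k| \right) \right)}$$ (with $1/0=\infty$), there exists a projection $p$ in $\mathfrak{M}$ such that $$\max_{1 \leq k \leq n} \frac{1}{2^{k-1}}\, \tau \left( e_{(2\lambda, \infty)}(|s_k|) \right) \leq \tau(p) \leq M_{\lambda}\, \tau \left( e_{(\frac{\lambda}{2}, \infty)}( |s_n| ) \right).$$
   Context: $\mathfrak{M}$ is a von Neumann algebra on a Hilbert space equipped with a normal faithful tracial state $\tau$; its elements are called (noncommutative) random variables. For self-adjoint $x\in\mathfrak{M}$ and a Borel set $B\subseteq\mathbb{R}$, $e_B(x)$ is the spectral projection of $x$ corresponding to $B$. For $S\subseteq \mathfrak{M}$, $W^*(S)$ is the $W^*$-algebra (von Neumann subalgebra) generated by $S$. A sequence $(x_k)_{k=1}^n$ in $\mathfrak{M}$ is weakly fully independent if for every $1<j\leq n$ one has $\tau(ab)=\tau(a)\tau(b)$ for all $a\in W^*(x_1,\ldots,x_{j-1})$ and $b\in W^*(x_j,\ldots,x_n)$.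
   Formalization: When the minimum is 0, so that M_λ = ∞, the upper bound is read as void even if τ(e_{(λ/2,∞)}(|s_n|)) = 0; with ∞·0 = 0 the claim fails (n = 2, x_1 = 10λ·1, x_2 = −10λ·1). *)

theory Defs
  imports "HOL-Analysis.Analysis"
begin

section \<open>Complex Hilbert spaces\<close>

text \<open>The inner product is linear in the first argument.\<close>

class complex_inner_space = real_normed_vector +
  fixes scaleC :: "complex \<Rightarrow> 'a \<Rightarrow> 'a"  (infixr \<open>*\<^sub>C\<close> 75)
    and cinner :: "'a \<Rightarrow> 'a \<Rightarrow> complex"
  assumes scaleC_add_right: "c *\<^sub>C (u + v) = c *\<^sub>C u + c *\<^sub>C v"
    and scaleC_add_left: "(c + d) *\<^sub>C v = c *\<^sub>C v + d *\<^sub>C v"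
    and scaleC_scaleC: "c *\<^sub>C d *\<^sub>C v = (c * d) *\<^sub>C v"
    and scaleC_of_real: "complex_of_real r *\<^sub>C v = r *\<^sub>R v"
    and cinner_commute: "cinner u v = cnj (cinner v u)"
    and cinner_add_left: "cinner (u + v) w = cinner u w + cinner v w"
    and cinner_scaleC_left: "cinner (c *\<^sub>C u) v = c * cinner u v"
    and cinner_self: "cinner v v = complex_of_real ((norm v)\<^sup>2)"

class complex_hilbert_space = complex_inner_space + complete_space

section \<open>Bounded operators\<close>

text \<open>The library type of bounded operators consists of the real-linear ones; the complex-linear
  ones are carved out as a set. Product and unit are \<open>(o\<^sub>L)\<close> and \<open>id_blinfun\<close>.\<close>

type_synonym 'h operator = "'h \<Rightarrow>\<^sub>L 'h"

definition bounded_operators :: "'h::complex_hilbert_space operator set" where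
  "bounded_operators = {T. \<forall>c v. blinfun_apply T (c *\<^sub>C v) = c *\<^sub>C blinfun_apply T v}"

lemma norm_scaleC:
  fixes v :: "'h::complex_inner_space"
  shows "norm (c *\<^sub>C v) = cmod c * norm v"
proof -
  have "cinner (c *\<^sub>C v) (c *\<^sub>C v) = c * cnj (c * cinner v v)"
    by (metis cinner_commute cinner_scaleC_left)
  also have "\<dots> = complex_of_real ((cmod c * norm v)\<^sup>2)"
    by (simp add: cinner_self power_mult_distrib complex_norm_square del: of_real_power)
  finally have "(norm (c *\<^sub>C v))\<^sup>2 = (cmod c * norm v)\<^sup>2"
    by (simp only: cinner_self of_real_eq_iff)
  then show ?thesis
    by (simp add: power2_eq_iff_nonneg)
qed

lemma scaleC_scaleR:
  fixes v :: "'h::complex_inner_space"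
  shows "c *\<^sub>C (r *\<^sub>R v) = r *\<^sub>R (c *\<^sub>C v)"
  by (metis scaleC_of_real scaleC_scaleC mult.commute)

lemma bounded_linear_scaleC: "bounded_linear (\<lambda>v::'h::complex_inner_space. c *\<^sub>C v)"
  by (rule bounded_linear_intro[where K = "cmod c"])
    (simp_all add: scaleC_add_right scaleC_scaleR norm_scaleC mult.commute)

lift_definition scale_op :: "complex \<Rightarrow> 'h::complex_hilbert_space operator \<Rightarrow> 'h operator"
  is "\<lambda>c T v. c *\<^sub>C T v"
  by (rule bounded_linear_compose[OF bounded_linear_scaleC])

definition op_adjoint :: "'h::complex_hilbert_space operator \<Rightarrow> 'h operator" where
  "op_adjoint T = (THE S. \<forall>u v. cinner (blinfun_apply T u) v = cinner u (blinfun_apply S v))"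

definition self_adjoint :: "'h::complex_hilbert_space operator \<Rightarrow> bool" where
  "self_adjoint T \<longleftrightarrow> T \<in> bounded_operators \<and> op_adjoint T = T"

definition projection_op :: "'h::complex_hilbert_space operator \<Rightarrow> bool" where
  "projection_op P \<longleftrightarrow> self_adjoint P \<and> P o\<^sub>L P = P"

definition positive_op :: "'h::complex_hilbert_space operator \<Rightarrow> bool" where
  "positive_op T \<longleftrightarrow>
     T \<in> bounded_operators \<and> (\<forall>v. cinner (blinfun_apply T v) v \<in> \<real>\<^sub>\<ge>\<^sub>0)"

definition op_le :: "'h::complex_hilbert_space operator \<Rightarrow> 'h operator \<Rightarrow> bool" where
  "op_le S T \<longleftrightarrow> positive_op (T - S)"

text \<open>The absolute value is the positive square root of \<open>x\<^sup>* x\<close>.\<close>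

definition op_abs :: "'h::complex_hilbert_space operator \<Rightarrow> 'h operator" where
  "op_abs x = (THE y. positive_op y \<and> y o\<^sub>L y = op_adjoint x o\<^sub>L x)"

section \<open>Spectral projections\<close>

text \<open>Projection-valued measures on the Borel sets of the real line, with countable additivity in
  the strong operator topology. Values at non-Borel sets are irrelevant.\<close>

definition projection_valued_measure ::
    "(real set \<Rightarrow> 'h::complex_hilbert_space operator) \<Rightarrow> bool" where
  "projection_valued_measure E \<longleftrightarrow>
     (\<forall>B\<in>sets borel. projection_op (E B)) \<and>
     E UNIV = id_blinfun \<and>
     (\<forall>A\<in>sets borel. \<forall>B\<in>sets borel. E (A \<inter> B) = E A o\<^sub>L E B) \<and>
     (\<forall>A. range A \<subseteq> sets borel \<longrightarrow> disjoint_family A \<longrightarrow>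
        (\<forall>v. (\<lambda>i::nat. blinfun_apply (E (A i)) v) sums blinfun_apply (E (\<Union>i. A i)) v))"

text \<open>The scalar measure sending \<open>B\<close> to \<open>\<langle>E(B)v, v\<rangle>\<close>.\<close>

definition scalar_measure ::
    "(real set \<Rightarrow> 'h::complex_hilbert_space operator) \<Rightarrow> 'h \<Rightarrow> real measure" where
  "scalar_measure E v =
     measure_of UNIV (sets borel) (\<lambda>B. ennreal (Re (cinner (blinfun_apply (E B) v) v)))"

text \<open>\<open>E\<close> is the spectral measure of the bounded self-adjoint operator \<open>x\<close>, i.e.
  \<open>x = \<integral>t dE(t)\<close> in the weak sense. The bounded support makes \<open>t\<close> integrable against every
  scalar measure, and the diagonal matrix entries determine \<open>x\<close> by polarization.\<close>

definition spectral_measure_of ::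
    "'h::complex_hilbert_space operator \<Rightarrow> (real set \<Rightarrow> 'h operator) \<Rightarrow> bool" where
  "spectral_measure_of x E \<longleftrightarrow>
     projection_valued_measure E \<and>
     (\<exists>K. E {-K..K} = id_blinfun) \<and>
     (\<forall>v. cinner (blinfun_apply x v) v = complex_of_real (LINT t|scalar_measure E v. t))"

text \<open>The spectral projection \<open>e\<^sub>B(x)\<close>, meaningful for self-adjoint \<open>x\<close> and Borel \<open>B\<close>.\<close>

definition spectral_projection ::
    "real set \<Rightarrow> 'h::complex_hilbert_space operator \<Rightarrow> 'h operator" where
  "spectral_projection B x = (THE P. \<exists>E. spectral_measure_of x E \<and> P = E B)"

section \<open>Von Neumann algebras and traces\<close>

definition commutant :: "'h::complex_hilbert_space operator set \<Rightarrow> 'h operator set" where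
  "commutant S = {T \<in> bounded_operators. \<forall>a\<in>S. T o\<^sub>L a = a o\<^sub>L T}"

definition von_neumann_algebra :: "'h::complex_hilbert_space operator set \<Rightarrow> bool" where
  "von_neumann_algebra M \<longleftrightarrow>
     M \<subseteq> bounded_operators \<and> (\<forall>a\<in>M. op_adjoint a \<in> M) \<and> commutant (commutant M) = M"

definition W_star :: "'h::complex_hilbert_space operator set \<Rightarrow> 'h operator set" where
  "W_star S = \<Inter>{N. von_neumann_algebra N \<and> S \<subseteq> N}"

definition state_on ::
    "'h::complex_hilbert_space operator set \<Rightarrow> ('h operator \<Rightarrow> complex) \<Rightarrow> bool" where
  "state_on M \<tau> \<longleftrightarrow>
     (\<forall>a\<in>M. \<forall>b\<in>M. \<tau> (a + b) = \<tau> a + \<tau> b) \<and>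
     (\<forall>c. \<forall>a\<in>M. \<tau> (scale_op c a) = c * \<tau> a) \<and>
     (\<forall>a\<in>M. positive_op a \<longrightarrow> \<tau> a \<in> \<real>\<^sub>\<ge>\<^sub>0) \<and>
     \<tau> id_blinfun = 1"

definition tracial_on ::
    "'h::complex_hilbert_space operator set \<Rightarrow> ('h operator \<Rightarrow> complex) \<Rightarrow> bool" where
  "tracial_on M \<tau> \<longleftrightarrow> (\<forall>a\<in>M. \<forall>b\<in>M. \<tau> (a o\<^sub>L b) = \<tau> (b o\<^sub>L a))"

definition faithful_on ::
    "'h::complex_hilbert_space operator set \<Rightarrow> ('h operator \<Rightarrow> complex) \<Rightarrow> bool" where
  "faithful_on M \<tau> \<longleftrightarrow> (\<forall>a\<in>M. positive_op a \<longrightarrow> \<tau> a = 0 \<longrightarrow> a = 0)"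

definition is_lub_in ::
    "'h::complex_hilbert_space operator set \<Rightarrow> 'h operator set \<Rightarrow> 'h operator \<Rightarrow> bool" where
  "is_lub_in M D a \<longleftrightarrow>
     a \<in> M \<and> self_adjoint a \<and> (\<forall>d\<in>D. op_le d a) \<and>
     (\<forall>b\<in>M. self_adjoint b \<longrightarrow> (\<forall>d\<in>D. op_le d b) \<longrightarrow> op_le a b)"

text \<open>Normality: preservation of suprema of bounded increasing nets of self-adjoint elements. Nets
  are represented by upward directed sets.\<close>

definition normal_on ::
    "'h::complex_hilbert_space operator set \<Rightarrow> ('h operator \<Rightarrow> complex) \<Rightarrow> bool" where
  "normal_on M \<tau> \<longleftrightarrow>
     (\<forall>D a. D \<subseteq> M \<longrightarrow> D \<noteq> {} \<longrightarrow> (\<forall>d\<in>D. self_adjoint d) \<longrightarrow>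
        (\<forall>d\<in>D. \<forall>d'\<in>D. \<exists>e\<in>D. op_le d e \<and> op_le d' e) \<longrightarrow>
        is_lub_in M D a \<longrightarrow>
        Re (\<tau> a) = (SUP d\<in>D. Re (\<tau> d)))"

definition normal_faithful_tracial_state ::
    "'h::complex_hilbert_space operator set \<Rightarrow> ('h operator \<Rightarrow> complex) \<Rightarrow> bool" where
  "normal_faithful_tracial_state M \<tau> \<longleftrightarrow>
     state_on M \<tau> \<and> tracial_on M \<tau> \<and> faithful_on M \<tau> \<and> normal_on M \<tau>"

definition weakly_fully_independent ::
    "'h::complex_hilbert_space operator set \<Rightarrow> ('h operator \<Rightarrow> complex) \<Rightarrow>
     (nat \<Rightarrow> 'h operator) \<Rightarrow> nat \<Rightarrow> bool" where
  "weakly_fully_independent M \<tau> x n \<longleftrightarrow>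
     (\<forall>k\<in>{1..n}. x k \<in> M) \<and>
     (\<forall>j. 1 < j \<and> j \<le> n \<longrightarrow>
        (\<forall>a\<in>W_star (x ` {1..<j}). \<forall>b\<in>W_star (x ` {j..n}). \<tau> (a o\<^sub>L b) = \<tau> a * \<tau> b))"

end

theory Submission
  imports Defs "HOL-Probability.Distribution_Functions"
begin

text \<open>A single index suffices. If \<open>k\<close> maximises
  \<open>\<tau>(P k)\<close> with \<open>P k = e_(2\<lambda>, \<infinity>)(|s k|)\<close>, take \<open>p = P k\<close>; all the factors
  \<open>2\<^bsup>1-k\<^esup>\<close> are at most \<open>1\<close>. Put \<open>Q k = e_(-\<infinity>, \<lambda>/2](|s n - s k|)\<close>.
  Since \<open>s k\<close> commutes with \<open>s n\<close>, the projections \<open>P k\<close>, \<open>Q k\<close> and \<open>G = e_(\<lambda>/2, \<infinity>)(|s n|)\<close> commute,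
  and the triangle inequality gives \<open>P k Q k \<le> G\<close>; independence then yields
  \<open>\<tau>(P k) \<tau>(Q k) = \<tau>(P k Q k) \<le> \<tau>(G)\<close>.

  The spectral measure of a bounded symmetric operator \<open>T\<close> arises as follows. The square
  root of \<open>(T - t)\<^sup>2\<close> gives the projection \<open>F t\<close> of \<open>(-\<infinity>, t]\<close>; the distribution functions
  \<open>t \<mapsto> \<langle>F t v, v\<rangle>\<close> define Stieltjes measures \<open>\<mu>_v\<close>; and a Dynkin argument shows that every Borel set
  \<open>B\<close> has a projection \<open>E B\<close> with \<open>\<mu>_v(B) = \<langle>E B v, v\<rangle>\<close>. All of this uses only the real inner product
  \<open>Re \<langle>u, v\<rangle>\<close>: complex linearity of the projections is commutation with the scalar multiplications.\<close>

section \<open>The real inner product and orthogonal projections\<close>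

text \<open>\<open>op_adjoint\<close>, \<open>op_abs\<close> and \<open>spectral_projection\<close>
  are definite descriptions, so each needs existence and uniqueness before anything can be said of
  it. For spectral projections, uniqueness is established on half lines: for any spectral measure E
  of T, \<open>E {..t}\<close> satisfies \<open>lower_spectral_projection\<close>, a condition on
  the quadratic form of T with at most one solution among commuting projections.

  The commutation comes from a property carried through every construction: the square root, the
  projections \<open>F t\<close> and the projections \<open>E B\<close> commute with every bounded
  real-linear operator that commutes with T. The same property later yields complex linearity,
  membership in W*-algebras through the double commutant, and the commutation of the spectral
  projections of \<open>s k\<close>, \<open>s n\<close> and \<open>s n - s k\<close>.

  The lower bound is a maximum of traces, not the trace of a supremum of projections. Hence no first
  passage decomposition enters: each index is estimated separately, and one that attains the maximum
  supplies the witness.\<close>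

instance complex_hilbert_space \<subseteq> banach ..

definition rinner :: "'h::complex_inner_space \<Rightarrow> 'h \<Rightarrow> real"  (infixl \<open>\<bullet>\<^sub>R\<close> 70) where
  "u \<bullet>\<^sub>R v = Re (cinner u v)"

lemma rinner_commute: "u \<bullet>\<^sub>R v = v \<bullet>\<^sub>R u"
  by (simp add: rinner_def cinner_commute[of u v])

lemma rinner_self: "v \<bullet>\<^sub>R v = (norm v)\<^sup>2"
  by (simp add: rinner_def cinner_self del: of_real_power)

lemma rinner_add_left: "(u + v) \<bullet>\<^sub>R w = u \<bullet>\<^sub>R w + v \<bullet>\<^sub>R w"
  by (simp add: rinner_def cinner_add_left)

lemma rinner_scaleR_left: "(r *\<^sub>R u) \<bullet>\<^sub>R w = r * (u \<bullet>\<^sub>R w)"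
  by (simp add: rinner_def cinner_scaleC_left flip: scaleC_of_real)

text \<open>The degenerate case \<open>c = 0\<close> is kept because the forms in question are only
  semidefinite; there a nonconstant affine function would take negative values.\<close>

lemma quadratic_nonneg_imp_discriminant:
  fixes a b c :: real
  assumes "\<And>r. 0 \<le> a + 2 * r * b + r\<^sup>2 * c" "0 \<le> c"
  shows "b\<^sup>2 \<le> a * c"
proof (cases "c = 0")
  case True
  show ?thesis
  proof (cases "b = 0")
    case False
    \<comment> \<open>This \<open>r\<close> is the point where the affine function takes the value
      -1.\<close>
    have "0 \<le> a + 2 * (- (a + 1) / (2 * b)) * b" using assms(1)[of "- (a + 1) / (2 * b)"] True by simp
    also have "\<dots> = - 1" using False by (simp add: field_simps)
    finally show ?thesis by simp
  qed (use True in simp)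
next
  case False
  \<comment> \<open>Evaluation at the minimiser \<open>r = - b / c\<close>, multiplied by
    \<open>c\<close> to clear the denominator.\<close>
  have "0 \<le> (a + 2 * (- b / c) * b + (- b / c)\<^sup>2 * c) * c"
    using assms by (intro mult_nonneg_nonneg)
  also have "\<dots> = a * c - b\<^sup>2"
    using False by (simp add: field_simps power2_eq_square)
  finally show ?thesis by simp
qed

text \<open>The identity map gives the ordinary Cauchy-Schwarz inequality; with
  \<open>v = A u\<close> the inequality lets the quadratic form control the norm of
  \<open>A u\<close>.\<close>

lemma positive_form_Cauchy_Schwarz:
  assumes "linear A" and symm: "\<And>u v. A u \<bullet>\<^sub>R v = u \<bullet>\<^sub>R A v" and pos: "\<And>v. 0 \<le> A v \<bullet>\<^sub>R v"
  shows "(A u \<bullet>\<^sub>R v)\<^sup>2 \<le> (A u \<bullet>\<^sub>R u) * (A v \<bullet>\<^sub>R v)"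
proof (rule quadratic_nonneg_imp_discriminant)
  fix r :: real
  have "A (u + r *\<^sub>R v) \<bullet>\<^sub>R (u + r *\<^sub>R v) =
      A u \<bullet>\<^sub>R u + r * (A v \<bullet>\<^sub>R u) + (r * (A u \<bullet>\<^sub>R v) + r * (r * (A v \<bullet>\<^sub>R v)))"
    by (simp add: linear_add[OF assms(1)] linear_scale[OF assms(1)] rinner_add_left
        rinner_scaleR_left rinner_commute[of _ "u + r *\<^sub>R v"] rinner_commute[of u]
        rinner_commute[of v] algebra_simps)
  also have "A v \<bullet>\<^sub>R u = A u \<bullet>\<^sub>R v" by (metis symm rinner_commute)
  finally show "0 \<le> A u \<bullet>\<^sub>R u + 2 * r * (A u \<bullet>\<^sub>R v) + r\<^sup>2 * (A v \<bullet>\<^sub>R v)"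
    using pos[of "u + r *\<^sub>R v"] by (simp add: power2_eq_square algebra_simps)
qed (rule pos)

lemma rinner_Cauchy_Schwarz: "\<bar>u \<bullet>\<^sub>R v\<bar> \<le> norm u * norm v"
proof -
  have "(u \<bullet>\<^sub>R v)\<^sup>2 \<le> (u \<bullet>\<^sub>R u) * (v \<bullet>\<^sub>R v)"
    using positive_form_Cauchy_Schwarz[of "\<lambda>x. x" u v] by (simp add: linear_id[unfolded id_def] rinner_self)
  then have "\<bar>u \<bullet>\<^sub>R v\<bar>\<^sup>2 \<le> (norm u * norm v)\<^sup>2" by (simp add: rinner_self power_mult_distrib)
  then show ?thesis by (rule power2_le_imp_le) simp
qed

lemma bounded_bilinear_rinner: "bounded_bilinear (\<bullet>\<^sub>R)"
proof
  show "\<exists>K. \<forall>(a::'a) b. norm (a \<bullet>\<^sub>R b) \<le> norm a * norm b * K"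
    by (rule exI[of _ 1]) (simp add: rinner_Cauchy_Schwarz)
qed (simp_all add: rinner_add_left rinner_scaleR_left rinner_commute[of _ "_ + _"]
      rinner_commute[of _ "_ *\<^sub>R _"], simp_all add: rinner_commute)

interpretation rinner: bounded_bilinear "(\<bullet>\<^sub>R)" by (rule bounded_bilinear_rinner)

lemma norm_add_square: "(norm (u + v :: 'h::complex_inner_space))\<^sup>2 = (norm u)\<^sup>2 + 2 * (u \<bullet>\<^sub>R v) + (norm v)\<^sup>2"
  by (simp add: rinner.add_left rinner.add_right rinner_commute[of v u] flip: rinner_self)

lemma norm_diff_square: "(norm (u - v :: 'h::complex_inner_space))\<^sup>2 = (norm u)\<^sup>2 - 2 * (u \<bullet>\<^sub>R v) + (norm v)\<^sup>2"
  by (simp add: rinner.diff_left rinner.diff_right rinner_commute[of v u] flip: rinner_self)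

lemma rinner_eqI: "(\<And>u. u \<bullet>\<^sub>R v = u \<bullet>\<^sub>R w) \<Longrightarrow> v = w"
proof -
  assume "\<And>u. u \<bullet>\<^sub>R v = u \<bullet>\<^sub>R w"
  then have "(v - w) \<bullet>\<^sub>R (v - w) = 0" by (simp add: rinner.diff_right)
  then show "v = w" by (simp add: rinner_self)
qed

text \<open>After squaring, \<open>(norm z)\<^sup>2\<close> cancels, so the quadratic in
  \<open>r\<close> has constant term 0 and its discriminant bound has right-hand side 0.\<close>

lemma minimal_distance_orthogonal:
  fixes z w :: "'h::complex_inner_space"
  assumes "\<And>r. norm z \<le> norm (z + r *\<^sub>R w)"
  shows "z \<bullet>\<^sub>R w = 0"
proof -
  have "(z \<bullet>\<^sub>R w)\<^sup>2 \<le> 0 * (norm w)\<^sup>2"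
  proof (rule quadratic_nonneg_imp_discriminant)
    fix r
    have "(norm z)\<^sup>2 \<le> (norm (z + r *\<^sub>R w))\<^sup>2" using assms by (simp add: power_mono)
    then show "0 \<le> 0 + 2 * r * (z \<bullet>\<^sub>R w) + r\<^sup>2 * (norm w)\<^sup>2"
      by (simp add: norm_add_square rinner.scaleR_right power_mult_distrib)
  qed simp
  then show ?thesis by simp
qed

text \<open>\<open>c\<close> is the point of \<open>C\<close> nearest to \<open>v\<close>. A
  minimising sequence is Cauchy by the parallelogram law, since the midpoint of two of its terms
  lies in \<open>C\<close> and so is no closer than the infimum \<open>d\<close>.\<close>

lemma orthogonal_decomposition_exists:
  fixes C :: "'h::complex_hilbert_space set"
  assumes "subspace C" "closed C"
  shows "\<exists>c\<in>C. \<forall>w\<in>C. (v - c) \<bullet>\<^sub>R w = 0"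
proof -
  have ne: "0 \<in> C" using assms(1) by (rule subspace_0)
  define d where "d = (INF c\<in>C. norm (v - c))"
  have bdd: "bdd_below ((\<lambda>c. norm (v - c)) ` C)" by (rule bdd_belowI[of _ 0]) auto
  have d_le: "d \<le> norm (v - c)" if "c \<in> C" for c
    unfolding d_def by (rule cINF_lower[OF bdd that])
  have d0: "0 \<le> d" unfolding d_def using ne by (intro cINF_greatest) auto
  have "\<exists>c\<in>C. norm (v - c) < d + inverse (real (Suc n))" for n
  proof -
    have "(INF c\<in>C. norm (v - c)) < d + inverse (real (Suc n))" unfolding d_def[symmetric] by simp
    then show ?thesis using ne by (subst (asm) cINF_less_iff[OF _ bdd]) auto
  qed
  then obtain c where c: "\<And>n. c n \<in> C" "\<And>n. norm (v - c n) < d + inverse (real (Suc n))" by metis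
  \<comment> \<open>\<open>e n\<close> bounds the excess of the squared distance of
    \<open>c n\<close> over the minimum \<open>d\<^sup>2\<close>.\<close>
  define e where "e n = (d + inverse (real (Suc n)))\<^sup>2 - d\<^sup>2" for n
  have e: "e \<longlonglongrightarrow> 0"
  proof -
    have "e \<longlonglongrightarrow> (d + 0)\<^sup>2 - d\<^sup>2"
      unfolding e_def by (intro tendsto_intros LIMSEQ_inverse_real_of_nat)
    then show ?thesis by simp
  qed
  have close: "(norm (c m - c n))\<^sup>2 \<le> 2 * e m + 2 * e n" for m n
  proof -
    have "(1/2) *\<^sub>R (c m + c n) \<in> C" using assms(1) c(1) by (simp add: subspace_scale subspace_add)
    then have "d \<le> norm (v - (1/2) *\<^sub>R (c m + c n))" by (rule d_le)
    then have "d\<^sup>2 \<le> (norm (v - (1/2) *\<^sub>R (c m + c n)))\<^sup>2" using d0 by (simp add: power_mono)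
    \<comment> \<open>Parallelogram law for \<open>v - c m\<close> and
      \<open>v - c n\<close>.\<close>
    moreover have "(norm (c m - c n))\<^sup>2 + 4 * (norm (v - (1/2) *\<^sub>R (c m + c n)))\<^sup>2 =
       2 * (norm (v - c m))\<^sup>2 + 2 * (norm (v - c n))\<^sup>2"
      by (simp add: norm_diff_square rinner.add_left rinner.add_right rinner.scaleR_right rinner.scaleR_left
          power_mult_distrib norm_add_square power_divide field_simps)
    moreover have "(norm (v - c k))\<^sup>2 \<le> d\<^sup>2 + e k" for k
      using c(2)[of k] d0 by (auto simp: e_def intro!: power_mono less_imp_le)
    from this[of m] this[of n] have "(norm (v - c m))\<^sup>2 \<le> d\<^sup>2 + e m" "(norm (v - c n))\<^sup>2 \<le> d\<^sup>2 + e n" .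
    ultimately show ?thesis by linarith
  qed
  have "Cauchy c"
  proof (rule metric_CauchyI)
    fix \<epsilon> :: real assume "0 < \<epsilon>"
    then have "0 < \<epsilon>\<^sup>2 / 4" by simp
    from order_tendstoD(2)[OF e this] obtain N where N: "\<And>n. N \<le> n \<Longrightarrow> e n < \<epsilon>\<^sup>2 / 4"
      by (auto simp: eventually_sequentially)
    have "dist (c m) (c n) < \<epsilon>" if "N \<le> m" "N \<le> n" for m n
    proof -
      have "(norm (c m - c n))\<^sup>2 < \<epsilon>\<^sup>2" using close[of m n] N[OF that(1)] N[OF that(2)] by linarith
      then show ?thesis using \<open>0 < \<epsilon>\<close> by (simp add: dist_norm power_less_imp_less_base)
    qed
    then show "\<exists>M. \<forall>m\<ge>M. \<forall>n\<ge>M. dist (c m) (c n) < \<epsilon>" by blast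
  qed
  then obtain l where l: "c \<longlonglongrightarrow> l" using Cauchy_convergent_iff convergent_def by blast
  have lC: "l \<in> C" using closed_sequentially[OF assms(2)] c(1) l by blast
  have "norm (v - l) \<le> d"
  proof (rule LIMSEQ_le)
    show "(\<lambda>n. norm (v - c n)) \<longlonglongrightarrow> norm (v - l)" by (intro tendsto_intros l)
    show "(\<lambda>n. d + inverse (real (Suc n))) \<longlonglongrightarrow> d"
      using tendsto_add[OF tendsto_const LIMSEQ_inverse_real_of_nat] by simp
    show "\<exists>N. \<forall>n\<ge>N. norm (v - c n) \<le> d + inverse (real (Suc n))"
      using c(2) less_imp_le by blast
  qed
  have "(v - l) \<bullet>\<^sub>R w = 0" if "w \<in> C" for w
  proof (rule minimal_distance_orthogonal)
    fix r
    have "l - r *\<^sub>R w \<in> C" using assms(1) lC that by (simp add: subspace_diff subspace_scale)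
    then have "d \<le> norm (v - (l - r *\<^sub>R w))" by (rule d_le)
    then show "norm (v - l) \<le> norm (v - l + r *\<^sub>R w)" using \<open>norm (v - l) \<le> d\<close> by (simp add: algebra_simps)
  qed
  with lC show ?thesis by blast
qed

text \<open>Linearity follows from uniqueness of the orthogonal decomposition, the norm bound from
  Pythagoras.\<close>

lemma orthogonal_projection_exists:
  fixes C :: "'h::complex_hilbert_space set"
  assumes C: "subspace C" "closed C"
  shows "\<exists>P::'h operator. (\<forall>v. P v \<in> C) \<and> (\<forall>v. \<forall>w\<in>C. (v - P v) \<bullet>\<^sub>R w = 0)"
proof -
  obtain p where p: "\<And>v. p v \<in> C" "\<And>v w. w \<in> C \<Longrightarrow> (v - p v) \<bullet>\<^sub>R w = 0"
    using orthogonal_decomposition_exists[OF C] by metis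
  have unique: "p v = c" if "c \<in> C" "\<And>w. w \<in> C \<Longrightarrow> (v - c) \<bullet>\<^sub>R w = 0" for v c
  proof -
    have "p v - c \<in> C" using C(1) p(1) that(1) by (rule subspace_diff)
    then have "(v - c) \<bullet>\<^sub>R (p v - c) = 0" "(v - p v) \<bullet>\<^sub>R (p v - c) = 0"
      using p(2) that(2) by auto
    then have "(p v - c) \<bullet>\<^sub>R (p v - c) = 0" by (simp add: rinner.diff_left)
    then show ?thesis by (simp add: rinner_self)
  qed
  have "bounded_linear p"
  proof (rule bounded_linear_intro[where K = 1])
    fix u v and r :: real
    have "(u + v) - (p u + p v) = (u - p u) + (v - p v)" by simp
    then show "p (u + v) = p u + p v"
      using C(1) p by (intro unique) (simp_all only: subspace_add rinner.add_left add_0)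
    have "r *\<^sub>R u - r *\<^sub>R p u = r *\<^sub>R (u - p u)" by (simp add: scaleR_diff_right)
    then show "p (r *\<^sub>R u) = r *\<^sub>R p u"
      using C(1) p by (intro unique) (simp_all only: subspace_scale rinner.scaleR_left scaleR_zero_right)
    have "(norm u)\<^sup>2 = (norm (u - p u))\<^sup>2 + (norm (p u))\<^sup>2"
      using norm_add_square[of "u - p u" "p u"] p by simp
    then have "(norm (p u))\<^sup>2 \<le> (norm u)\<^sup>2" by simp
    then show "norm (p u) \<le> norm u * 1" by (simp add: power2_le_iff_abs_le)
  qed
  then show ?thesis using p by (intro exI[of _ "Blinfun p"]) (simp add: bounded_linear_Blinfun_apply)
qed

section \<open>Adjoints\<close>

text \<open>If \<open>f\<close> is not zero, its kernel has codimension one and \<open>z\<close>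
  spans the orthogonal complement; the scalar in front of \<open>z\<close> normalises the value at
  \<open>z\<close>.\<close>

lemma Riesz_representation:
  fixes f :: "'h::complex_hilbert_space \<Rightarrow> real"
  assumes f: "bounded_linear f"
  shows "\<exists>w. \<forall>u. f u = u \<bullet>\<^sub>R w"
proof (cases "\<forall>u. f u = 0")
  case True
  then show ?thesis by (intro exI[of _ 0]) (simp add: rinner.zero_right)
next
  case False
  then obtain a where a: "f a \<noteq> 0" by blast
  interpret f: bounded_linear f by (rule f)
  define C where "C = {u. f u = 0}"
  have "subspace C" by (auto simp: C_def subspace_def f.zero f.add f.scaleR)
  moreover have "closed C" unfolding C_def
    by (intro closed_Collect_eq continuous_intros f.continuous_on)
  ultimately obtain c where c: "c \<in> C" "\<And>w. w \<in> C \<Longrightarrow> (a - c) \<bullet>\<^sub>R w = 0"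
    using orthogonal_decomposition_exists by metis
  define z where "z = a - c"
  have fz: "f z = f a" using c(1) by (simp add: z_def f.diff C_def)
  have z: "z \<noteq> 0" using a fz f.zero by auto
  have "f u = u \<bullet>\<^sub>R ((f z / (norm z)\<^sup>2) *\<^sub>R z)" for u
  proof -
    have "u - (f u / f z) *\<^sub>R z \<in> C" using a fz by (simp add: C_def f.diff f.scaleR)
    then have "z \<bullet>\<^sub>R (u - (f u / f z) *\<^sub>R z) = 0" using c(2) z_def by simp
    then have "u \<bullet>\<^sub>R z = (f u / f z) * (norm z)\<^sup>2"
      by (simp add: rinner.diff_right rinner.scaleR_right rinner_self rinner_commute)
    then show ?thesis using z a fz by (simp add: rinner.scaleR_right)
  qed
  then show ?thesis by blast
qed

lemma real_adjoint_exists: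
  fixes T :: "'h::complex_hilbert_space operator"
  shows "\<exists>S::'h operator. \<forall>u v. T u \<bullet>\<^sub>R v = u \<bullet>\<^sub>R S v"
proof -
  have "\<exists>w. \<forall>u. T u \<bullet>\<^sub>R v = u \<bullet>\<^sub>R w" for v
    by (intro Riesz_representation bounded_linear_compose[OF rinner.bounded_linear_left])
      (rule blinfun.bounded_linear_right)
  then obtain s where s: "\<And>u v. T u \<bullet>\<^sub>R v = u \<bullet>\<^sub>R s v" by metis
  have "bounded_linear s"
  proof (rule bounded_linear_intro[where K = "norm T"])
    show "s (v + w) = s v + s w" for v w
      by (rule rinner_eqI) (simp add: rinner.add_right flip: s)
    show "s (r *\<^sub>R v) = r *\<^sub>R s v" for r v
      by (rule rinner_eqI) (simp add: rinner.scaleR_right flip: s)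
    show "norm (s v) \<le> norm v * norm T" for v
    proof -
      have "(norm (s v))\<^sup>2 = T (s v) \<bullet>\<^sub>R v" by (simp add: s rinner_self)
      also have "\<dots> \<le> norm (T (s v)) * norm v" using rinner_Cauchy_Schwarz abs_le_D1 by blast
      also have "\<dots> \<le> (norm T * norm (s v)) * norm v"
        by (intro mult_right_mono norm_blinfun) simp
      finally have "norm (s v) * norm (s v) \<le> norm (s v) * (norm v * norm T)"
        by (simp add: power2_eq_square algebra_simps)
      then show ?thesis
        by (cases "norm (s v) = 0") (simp_all add: mult_le_cancel_left)
    qed
  qed
  then show ?thesis using s by (intro exI[of _ "Blinfun s"]) (simp add: bounded_linear_Blinfun_apply)
qed

definition symmetric_op :: "'h::complex_hilbert_space operator \<Rightarrow> bool" where
  "symmetric_op T \<longleftrightarrow> (\<forall>u v. T u \<bullet>\<^sub>R v = u \<bullet>\<^sub>R T v)"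

lemma symmetric_opD: "symmetric_op T \<Longrightarrow> T u \<bullet>\<^sub>R v = u \<bullet>\<^sub>R T v"
  by (simp add: symmetric_op_def)

text \<open>Recovers the complex inner product from its real part, so that identities of real forms
  extend to \<open>cinner\<close> for complex-linear operators.\<close>

lemma Im_cinner: "Im (cinner u v) = - ((\<i> *\<^sub>C u) \<bullet>\<^sub>R v)"
  by (simp add: rinner_def cinner_scaleC_left)

lemma cinner_adjointI:
  fixes S T :: "'h::complex_hilbert_space operator"
  assumes "T \<in> bounded_operators" "\<And>u v. T u \<bullet>\<^sub>R v = u \<bullet>\<^sub>R S v"
  shows "cinner (T u) v = cinner u (S v)"
proof (rule complex_eqI)
  show "Re (cinner (T u) v) = Re (cinner u (S v))" using assms(2) by (simp add: rinner_def)
  show "Im (cinner (T u) v) = Im (cinner u (S v))"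
    unfolding Im_cinner using assms by (simp add: bounded_operators_def flip: assms(2))
qed

lemma op_adjointI:
  fixes S T :: "'h::complex_hilbert_space operator"
  assumes "T \<in> bounded_operators" "\<And>u v. T u \<bullet>\<^sub>R v = u \<bullet>\<^sub>R S v"
  shows "op_adjoint T = S"
  unfolding op_adjoint_def
proof (rule the_equality)
  show "\<forall>u v. cinner (T u) v = cinner u (S v)" using cinner_adjointI[OF assms] by blast
  fix S' :: "'h operator" assume S': "\<forall>u v. cinner (T u) v = cinner u (S' v)"
  have "u \<bullet>\<^sub>R S' v = u \<bullet>\<^sub>R S v" for u v using S' assms(2) by (metis rinner_def)
  then show "S' = S" by (intro blinfun_eqI rinner_eqI)
qed

lemma rinner_op_adjoint: "T \<in> bounded_operators \<Longrightarrow> T u \<bullet>\<^sub>R v = u \<bullet>\<^sub>R op_adjoint T v"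
  using real_adjoint_exists[of T] op_adjointI by metis

lemma self_adjoint_iff: "self_adjoint T \<longleftrightarrow> T \<in> bounded_operators \<and> symmetric_op T"
  unfolding self_adjoint_def symmetric_op_def by (metis op_adjointI rinner_op_adjoint)

lemma self_adjoint_cinner: "self_adjoint T \<Longrightarrow> cinner (T v) v = complex_of_real (T v \<bullet>\<^sub>R v)"
proof -
  assume T: "self_adjoint T"
  then have "cinner (T v) v = cinner v (T v)"
    by (intro cinner_adjointI) (simp_all add: self_adjoint_iff symmetric_op_def)
  then have "cinner (T v) v = cnj (cinner (T v) v)" by (metis cinner_commute)
  then have "Im (cinner (T v) v) = 0" by (metis Reals_cnj_iff complex_is_Real_iff)
  then show ?thesis by (simp add: complex_eq_iff rinner_def)
qed

text \<open>Polarisation: the vanishing imaginary part of the quadratic form makes the real form of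
  \<open>\<i> T\<close> skew, and inserting \<open>\<i> u\<close> for \<open>u\<close> turns
  skewness into symmetry of \<open>T\<close>.\<close>

lemma positive_op_imp_self_adjoint:
  assumes "positive_op T"
  shows "self_adjoint T"
proof -
  have T: "T \<in> bounded_operators" and real: "\<And>v. Im (cinner (T v) v) = 0"
    using assms by (auto simp: positive_op_def complex_nonneg_Reals_iff)
  have lin: "T (c *\<^sub>C v) = c *\<^sub>C T v" for c v using T by (simp add: bounded_operators_def)
  have skew: "(\<i> *\<^sub>C T u) \<bullet>\<^sub>R v = - ((\<i> *\<^sub>C T v) \<bullet>\<^sub>R u)" for u v
  proof -
    have "(\<i> *\<^sub>C T (u + v)) \<bullet>\<^sub>R (u + v) = 0" "(\<i> *\<^sub>C T u) \<bullet>\<^sub>R u = 0" "(\<i> *\<^sub>C T v) \<bullet>\<^sub>R v = 0"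
      using real by (simp_all add: Im_cinner)
    then show ?thesis
      by (simp add: blinfun.add_right scaleC_add_right rinner.add_left rinner.add_right)
  qed
  have i_skew: "(\<i> *\<^sub>C u) \<bullet>\<^sub>R v = - (u \<bullet>\<^sub>R (\<i> *\<^sub>C v))" for u v :: 'a
  proof -
    have "(\<i> *\<^sub>C v) \<bullet>\<^sub>R u = - Im (cinner v u)" by (simp add: Im_cinner)
    also have "\<dots> = Im (cinner u v)" by (subst cinner_commute) simp
    also have "\<dots> = - ((\<i> *\<^sub>C u) \<bullet>\<^sub>R v)" by (simp add: Im_cinner)
    finally show ?thesis by (simp add: rinner_commute)
  qed
  have ii: "\<i> *\<^sub>C \<i> *\<^sub>C u = - u" for u :: 'a
    using scaleC_of_real[of "-1" u] by (simp add: scaleC_scaleC)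
  have "T u \<bullet>\<^sub>R v = u \<bullet>\<^sub>R T v" for u v
  proof -
    have "(\<i> *\<^sub>C T (\<i> *\<^sub>C u)) \<bullet>\<^sub>R v = - ((\<i> *\<^sub>C T v) \<bullet>\<^sub>R (\<i> *\<^sub>C u))" by (rule skew)
    also have "(\<i> *\<^sub>C T v) \<bullet>\<^sub>R (\<i> *\<^sub>C u) = T v \<bullet>\<^sub>R u"
      by (simp add: i_skew ii rinner.minus_right)
    finally show ?thesis by (simp add: lin ii rinner.minus_left rinner.minus_right rinner_commute)
  qed
  then show ?thesis using T by (simp add: self_adjoint_iff symmetric_op_def)
qed

lemma positive_op_iff: "positive_op T \<longleftrightarrow> self_adjoint T \<and> (\<forall>v. 0 \<le> T v \<bullet>\<^sub>R v)"
proof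
  assume "positive_op T"
  then show "self_adjoint T \<and> (\<forall>v. 0 \<le> T v \<bullet>\<^sub>R v)"
    using positive_op_imp_self_adjoint by (auto simp: positive_op_def rinner_def complex_nonneg_Reals_iff)
next
  assume "self_adjoint T \<and> (\<forall>v. 0 \<le> T v \<bullet>\<^sub>R v)"
  then show "positive_op T"
    by (auto simp: positive_op_def self_adjoint_cinner) (simp add: self_adjoint_def)
qed

section \<open>Positive square roots\<close>

lemma blinfun_compose_eq_iff: "A o\<^sub>L B = C o\<^sub>L D \<longleftrightarrow> (\<forall>v. A (B v) = C (D v))"
  by (metis blinfun_apply_blinfun_compose blinfun_eqI)

lemma symmetric_op_lincomb:
  "symmetric_op A \<Longrightarrow> symmetric_op B \<Longrightarrow> symmetric_op (A + B)"
  "symmetric_op A \<Longrightarrow> symmetric_op B \<Longrightarrow> symmetric_op (A - B)"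
  "symmetric_op A \<Longrightarrow> symmetric_op (r *\<^sub>R A)"
  "symmetric_op id_blinfun"
  by (simp_all add: symmetric_op_def blinfun.add_left blinfun.diff_left blinfun.scaleR_left
      rinner.add_left rinner.add_right rinner.diff_left rinner.diff_right
      rinner.scaleR_left rinner.scaleR_right)

lemma symmetric_op_compose:
  "symmetric_op A \<Longrightarrow> symmetric_op B \<Longrightarrow> A o\<^sub>L B = B o\<^sub>L A \<Longrightarrow> symmetric_op (A o\<^sub>L B)"
  by (simp add: symmetric_op_def blinfun_compose_eq_iff)

lemma blinfun_positive_form_Cauchy_Schwarz:
  assumes "symmetric_op A" "\<And>v. 0 \<le> A v \<bullet>\<^sub>R v"
  shows "(A u \<bullet>\<^sub>R v)\<^sup>2 \<le> (A u \<bullet>\<^sub>R u) * (A v \<bullet>\<^sub>R v)"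
  using assms by (intro positive_form_Cauchy_Schwarz)
    (simp_all add: symmetric_op_def bounded_linear.linear blinfun.bounded_linear_right)

text \<open>Cauchy-Schwarz for the form, taken between \<open>v\<close> and \<open>A v\<close>,
  bounds the fourth power of the norm of \<open>A v\<close> by 0.\<close>

lemma positive_form_eq_0:
  assumes "symmetric_op A" "\<And>v. 0 \<le> A v \<bullet>\<^sub>R v" "A v \<bullet>\<^sub>R v = 0"
  shows "A v = 0"
  using blinfun_positive_form_Cauchy_Schwarz[OF assms(1,2), of v "A v"] assms(3)
  by (simp add: rinner_self)

text \<open>The form bound is asked for only at \<open>v\<close> and \<open>A v\<close>, so the
  lemma also applies on an \<open>A\<close>-invariant subspace where the bound fails to hold
  globally.\<close>

lemma norm_le_of_positive_form_le:
  assumes "symmetric_op A" "\<And>v. 0 \<le> A v \<bullet>\<^sub>R v" "0 \<le> c"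
    and "A v \<bullet>\<^sub>R v \<le> c * (norm v)\<^sup>2" "A (A v) \<bullet>\<^sub>R A v \<le> c * (norm (A v))\<^sup>2"
  shows "norm (A v) \<le> c * norm v"
proof (cases "A v = 0")
  case False
  have "((norm (A v))\<^sup>2)\<^sup>2 \<le> (A v \<bullet>\<^sub>R v) * (A (A v) \<bullet>\<^sub>R A v)"
    using blinfun_positive_form_Cauchy_Schwarz[OF assms(1,2), of v "A v"] by (simp add: rinner_self)
  also have "\<dots> \<le> (c * (norm v)\<^sup>2) * (c * (norm (A v))\<^sup>2)"
    using assms by (intro mult_mono) simp_all
  finally have "(norm (A v))\<^sup>2 * (norm (A v))\<^sup>2 \<le> (c * norm v)\<^sup>2 * (norm (A v))\<^sup>2"
    by (simp add: power2_eq_square algebra_simps)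
  then have "(norm (A v))\<^sup>2 \<le> (c * norm v)\<^sup>2"
    by (rule mult_right_le_imp_le) (simp add: False)
  then show ?thesis by (rule power2_le_imp_le) (simp add: assms)
qed (use assms in simp)

interpretation blinfun_compose: bounded_bilinear "(o\<^sub>L)"
  by (rule bounded_bilinear_blinfun_compose)

text \<open>The iteration \<open>Y \<mapsto> (B + Y\<^sup>2) / 2\<close> with \<open>B = 1 - A\<close> is dominated in norm by the scalar
  iteration \<open>y \<mapsto> (1 + y\<^sup>2) / 2\<close>, which increases to \<open>1\<close>; the square root is \<open>1 - lim Y\<close>.\<close>

fun sqrt_iter :: "'h::complex_hilbert_space operator \<Rightarrow> nat \<Rightarrow> 'h operator" where
  "sqrt_iter B 0 = 0"
| "sqrt_iter B (Suc n) = (1/2) *\<^sub>R (B + (sqrt_iter B n o\<^sub>L sqrt_iter B n))"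

fun sqrt_bound :: "nat \<Rightarrow> real" where
  "sqrt_bound 0 = 0"
| "sqrt_bound (Suc n) = (1 + (sqrt_bound n)\<^sup>2) / 2"

lemma sqrt_bound_range: "0 \<le> sqrt_bound n \<and> sqrt_bound n \<le> 1"
  by (induction n) (simp_all add: power_le_one)

lemma norm_sqrt_iter_le:
  assumes "norm B \<le> 1"
  shows "norm (sqrt_iter B n) \<le> sqrt_bound n"
proof (induction n)
  case (Suc n)
  have "norm (sqrt_iter B n o\<^sub>L sqrt_iter B n) \<le> norm (sqrt_iter B n) * norm (sqrt_iter B n)"
    by (rule norm_blinfun_compose)
  also have "\<dots> \<le> (sqrt_bound n)\<^sup>2"
    unfolding power2_eq_square using Suc sqrt_bound_range by (intro mult_mono) auto
  finally have "norm (B + (sqrt_iter B n o\<^sub>L sqrt_iter B n)) \<le> 1 + (sqrt_bound n)\<^sup>2"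
    using assms norm_triangle_ineq[of B "sqrt_iter B n o\<^sub>L sqrt_iter B n"] by linarith
  then show ?case by simp
qed simp

text \<open>With Y and Z consecutive iterates, Y^2 - Z^2 = Y (Y - Z) + (Y - Z) Z. The scalar
  iteration obeys the same identity, so its increments dominate by induction.\<close>

lemma norm_sqrt_iter_diff_le:
  assumes "norm B \<le> 1"
  shows "norm (sqrt_iter B (Suc n) - sqrt_iter B n) \<le> sqrt_bound (Suc n) - sqrt_bound n"
proof (induction n)
  case 0
  then show ?case using assms by simp
next
  case (Suc n)
  let ?Y = "sqrt_iter B (Suc n)" and ?Z = "sqrt_iter B n"
  have "(?Y o\<^sub>L ?Y) - (?Z o\<^sub>L ?Z) = (?Y o\<^sub>L (?Y - ?Z)) + ((?Y - ?Z) o\<^sub>L ?Z)"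
    by (simp del: sqrt_iter.simps add: blinfun_compose.diff_left blinfun_compose.diff_right)
  also have "norm \<dots> \<le> norm ?Y * norm (?Y - ?Z) + norm (?Y - ?Z) * norm ?Z"
    by (intro norm_triangle_le add_mono norm_blinfun_compose)
  also have "\<dots> \<le> sqrt_bound (Suc n) * (sqrt_bound (Suc n) - sqrt_bound n)
      + (sqrt_bound (Suc n) - sqrt_bound n) * sqrt_bound n"
    using Suc norm_sqrt_iter_le[OF assms] sqrt_bound_range order_trans[OF norm_ge_zero Suc]
    by (intro add_mono mult_mono) (simp_all del: sqrt_iter.simps sqrt_bound.simps)
  also have "\<dots> = (sqrt_bound (Suc n))\<^sup>2 - (sqrt_bound n)\<^sup>2"
    by (simp del: sqrt_bound.simps add: power2_eq_square algebra_simps)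
  finally have "norm ((?Y o\<^sub>L ?Y) - (?Z o\<^sub>L ?Z)) \<le> (sqrt_bound (Suc n))\<^sup>2 - (sqrt_bound n)\<^sup>2" .
  moreover have "sqrt_iter B (Suc (Suc n)) - ?Y = (1/2) *\<^sub>R ((?Y o\<^sub>L ?Y) - (?Z o\<^sub>L ?Z))"
  proof -
    have "sqrt_iter B (Suc (Suc n)) = (1/2) *\<^sub>R (B + (?Y o\<^sub>L ?Y))" by (rule sqrt_iter.simps)
    moreover have "?Y = (1/2) *\<^sub>R (B + (?Z o\<^sub>L ?Z))" by (rule sqrt_iter.simps)
    ultimately have "sqrt_iter B (Suc (Suc n)) - ?Y = (1/2) *\<^sub>R (B + (?Y o\<^sub>L ?Y)) - (1/2) *\<^sub>R (B + (?Z o\<^sub>L ?Z))"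
      by metis
    then show ?thesis by (simp del: sqrt_iter.simps add: scaleR_diff_right scaleR_add_right)
  qed
  moreover have "sqrt_bound (Suc (Suc n)) - sqrt_bound (Suc n) = ((sqrt_bound (Suc n))\<^sup>2 - (sqrt_bound n)\<^sup>2) / 2"
    using sqrt_bound.simps(2)[of "Suc n"] sqrt_bound.simps(2)[of n] by (simp only: ) (simp add: field_simps)
  ultimately show ?case by (simp del: sqrt_iter.simps sqrt_bound.simps)
qed

lemma sqrt_iter_symmetric_commute:
  assumes "symmetric_op B"
  shows "symmetric_op (sqrt_iter B n) \<and> (\<forall>C. C o\<^sub>L B = B o\<^sub>L C \<longrightarrow> C o\<^sub>L sqrt_iter B n = sqrt_iter B n o\<^sub>L C)"
proof (induction n)
  case 0
  then show ?case by (simp add: symmetric_op_def rinner.zero_left rinner.zero_right blinfun_compose_eq_iff blinfun.zero_right)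
next
  case (Suc n)
  then have "symmetric_op (sqrt_iter B n o\<^sub>L sqrt_iter B n)" using symmetric_op_compose by blast
  then have "symmetric_op (sqrt_iter B (Suc n))"
    using assms by (simp add: symmetric_op_lincomb)
  moreover have "C o\<^sub>L sqrt_iter B (Suc n) = sqrt_iter B (Suc n) o\<^sub>L C" if "C o\<^sub>L B = B o\<^sub>L C" for C
  proof -
    have "C o\<^sub>L sqrt_iter B n = sqrt_iter B n o\<^sub>L C" using that Suc by blast
    with that show ?thesis by (simp add: blinfun_compose_eq_iff blinfun.add_left blinfun.add_right
        blinfun.scaleR_left blinfun.scaleR_right)
  qed
  ultimately show ?case by blast
qed

lemma sqrt_iter_convergent:
  assumes "norm B \<le> 1"
  shows "convergent (sqrt_iter B)"
proof -
  have "Bseq sqrt_bound" using sqrt_bound_range by (intro BseqI'[where K = 1]) auto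
  moreover have "incseq sqrt_bound"
  proof (rule incseq_SucI)
    show "sqrt_bound n \<le> sqrt_bound (Suc n)" for n
      \<comment> \<open>Monotonicity of the scalar sequence is read off the norm estimate, whose
        left side is nonnegative.\<close>
      using order_trans[OF norm_ge_zero norm_sqrt_iter_diff_le[OF assms, of n]]
      by (simp del: sqrt_bound.simps)
  qed
  ultimately have "convergent sqrt_bound" by (simp add: Bseq_mono_convergent incseq_def)
  then obtain l where "sqrt_bound \<longlonglongrightarrow> l" by (auto simp: convergent_def)
  then have "summable (\<lambda>n. sqrt_bound (Suc n) - sqrt_bound n)" by (rule telescope_summable)
  then have "summable (\<lambda>n. sqrt_iter B (Suc n) - sqrt_iter B n)"
    using norm_sqrt_iter_diff_le[OF assms] by (intro summable_comparison_test[OF _ \<open>summable _\<close>]) auto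
  then have "convergent (\<lambda>n. \<Sum>i<n. sqrt_iter B (Suc i) - sqrt_iter B i)"
    by (simp add: summable_iff_convergent)
  then show ?thesis unfolding sum_lessThan_telescope by simp
qed

text \<open>The limit satisfies 2 Y = B + Y^2, which says (1 - Y)^2 = 1 - B = A. Positivity of 1 - Y
  follows from \<open>norm Y \<le> 1\<close>. Symmetry and commutation pass to the limit from the
  iterates, which are polynomials in B.\<close>

lemma sqrt_of_contraction_exists:
  fixes A :: "'h::complex_hilbert_space operator"
  assumes A: "symmetric_op A" and small: "norm (id_blinfun - A) \<le> 1"
  shows "\<exists>R. symmetric_op R \<and> (\<forall>v. 0 \<le> R v \<bullet>\<^sub>R v) \<and> R o\<^sub>L R = A \<and>
    (\<forall>C. C o\<^sub>L A = A o\<^sub>L C \<longrightarrow> C o\<^sub>L R = R o\<^sub>L C)"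
proof -
  define B where "B = id_blinfun - A"
  have B: "symmetric_op B" unfolding B_def by (intro symmetric_op_lincomb A)
  have nB: "norm B \<le> 1" using small by (simp add: B_def)
  obtain Y where Y: "sqrt_iter B \<longlonglongrightarrow> Y"
    using sqrt_iter_convergent[OF nB] by (auto simp: convergent_def)
  have Yv: "(\<lambda>n. sqrt_iter B n v) \<longlonglongrightarrow> Y v" for v
    by (intro blinfun.tendsto Y tendsto_const)
  have "(\<lambda>n. sqrt_iter B (Suc n)) \<longlonglongrightarrow> (1/2) *\<^sub>R (B + (Y o\<^sub>L Y))"
    unfolding sqrt_iter.simps
    by (intro tendsto_scaleR tendsto_const tendsto_add blinfun_compose.tendsto Y)
  then have "Y = (1/2) *\<^sub>R (B + (Y o\<^sub>L Y))"
    using LIMSEQ_Suc[OF Y] LIMSEQ_unique by blast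
  then have YY: "2 *\<^sub>R Y = B + (Y o\<^sub>L Y)"
    by (metis (no_types, lifting) divide_self_if scaleR_one scaleR_scaleR times_divide_eq_right mult.right_neutral zero_neq_numeral)
  define R where "R = id_blinfun - Y"
  have symY: "symmetric_op Y"
    unfolding symmetric_op_def
  proof (intro allI)
    fix u v
    have "(\<lambda>n. sqrt_iter B n u \<bullet>\<^sub>R v) \<longlonglongrightarrow> Y u \<bullet>\<^sub>R v" "(\<lambda>n. u \<bullet>\<^sub>R sqrt_iter B n v) \<longlonglongrightarrow> u \<bullet>\<^sub>R Y v"
      by (intro rinner.tendsto Yv tendsto_const)+
    then show "Y u \<bullet>\<^sub>R v = u \<bullet>\<^sub>R Y v"
      using sqrt_iter_symmetric_commute[OF B] LIMSEQ_unique by (simp add: symmetric_op_def)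
  qed
  have "norm Y \<le> 1"
    using norm_sqrt_iter_le[OF nB] sqrt_bound_range order_trans
    by (intro LIMSEQ_le_const2[OF tendsto_norm[OF Y]]) blast
  have pos: "0 \<le> R v \<bullet>\<^sub>R v" for v
  proof -
    have "Y v \<bullet>\<^sub>R v \<le> norm (Y v) * norm v" using rinner_Cauchy_Schwarz abs_le_D1 by blast
    also have "\<dots> \<le> (norm Y * norm v) * norm v" by (intro mult_right_mono norm_blinfun) simp
    also have "\<dots> \<le> (1 * norm v) * norm v" using \<open>norm Y \<le> 1\<close> by (intro mult_right_mono) simp_all
    finally show ?thesis by (simp add: R_def blinfun.diff_left rinner.diff_left rinner_self power2_eq_square)
  qed
  have sq: "R o\<^sub>L R = A"
  proof (rule blinfun_eqI)
    fix v
    have "2 *\<^sub>R Y v = B v + Y (Y v)" using YY by (metis blinfun.add_left blinfun.scaleR_left blinfun_apply_blinfun_compose)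
    then show "(R o\<^sub>L R) v = A v"
      by (simp add: R_def B_def blinfun.diff_left blinfun.diff_right scaleR_2 algebra_simps)
  qed
  have comm: "C o\<^sub>L R = R o\<^sub>L C" if "C o\<^sub>L A = A o\<^sub>L C" for C
  proof -
    have "C o\<^sub>L B = B o\<^sub>L C" using that
      by (simp add: B_def blinfun_compose_eq_iff blinfun.diff_left blinfun.diff_right)
    then have eq: "C o\<^sub>L sqrt_iter B n = sqrt_iter B n o\<^sub>L C" for n
      using sqrt_iter_symmetric_commute[OF B] by blast
    have "(\<lambda>n. C o\<^sub>L sqrt_iter B n) \<longlonglongrightarrow> (C o\<^sub>L Y)" "(\<lambda>n. sqrt_iter B n o\<^sub>L C) \<longlonglongrightarrow> (Y o\<^sub>L C)"
      by (intro blinfun_compose.tendsto Y tendsto_const)+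
    then have "C o\<^sub>L Y = Y o\<^sub>L C" using LIMSEQ_unique by (simp add: eq)
    then show ?thesis by (simp add: R_def blinfun_compose_eq_iff blinfun.diff_left blinfun.diff_right)
  qed
  have "symmetric_op R" unfolding R_def by (intro symmetric_op_lincomb symY)
  with pos sq comm show ?thesis by blast
qed

lemma positive_sqrt_exists:
  fixes A :: "'h::complex_hilbert_space operator"
  assumes A: "symmetric_op A" and pos: "\<And>v. 0 \<le> A v \<bullet>\<^sub>R v"
  shows "\<exists>R. symmetric_op R \<and> (\<forall>v. 0 \<le> R v \<bullet>\<^sub>R v) \<and> R o\<^sub>L R = A \<and>
    (\<forall>C. C o\<^sub>L A = A o\<^sub>L C \<longrightarrow> C o\<^sub>L R = R o\<^sub>L C)"
proof -
  \<comment> \<open>The summand 1 keeps the scaling factor positive when \<open>A = 0\<close>. After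
    scaling, the forms of \<open>A'\<close> and of its complement both lie between 0 and the squared
    norm, whence the complement is a contraction.\<close>
  define c where "c = norm A + 1"
  have c: "0 < c" by (simp add: c_def add_nonneg_pos)
  define A' where "A' = (1 / c) *\<^sub>R A"
  have A': "symmetric_op A'" unfolding A'_def by (intro symmetric_op_lincomb A)
  let ?B = "id_blinfun - A'"
  have B: "symmetric_op ?B" by (intro symmetric_op_lincomb A')
  have A'_form: "0 \<le> A' v \<bullet>\<^sub>R v" "A' v \<bullet>\<^sub>R v \<le> (norm v)\<^sup>2" for v
  proof -
    show "0 \<le> A' v \<bullet>\<^sub>R v" using pos c by (simp add: A'_def blinfun.scaleR_left rinner.scaleR_left)
    have "A v \<bullet>\<^sub>R v \<le> norm (A v) * norm v" using rinner_Cauchy_Schwarz abs_le_D1 by blast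
    also have "\<dots> \<le> (norm A * norm v) * norm v" by (intro mult_right_mono norm_blinfun) simp
    also have "\<dots> \<le> (c * norm v) * norm v" by (intro mult_right_mono) (simp_all add: c_def)
    finally show "A' v \<bullet>\<^sub>R v \<le> (norm v)\<^sup>2"
      using c by (simp add: A'_def blinfun.scaleR_left rinner.scaleR_left field_simps power2_eq_square)
  qed
  have "norm (?B v) \<le> 1 * norm v" for v
    using A'_form by (intro norm_le_of_positive_form_le B)
      (simp_all add: blinfun.diff_left rinner.diff_left rinner_self)
  then have "norm ?B \<le> 1" by (intro norm_blinfun_bound) simp_all
  from sqrt_of_contraction_exists[OF A' this] obtain R where
    R: "symmetric_op R" "\<And>v. 0 \<le> R v \<bullet>\<^sub>R v" "R o\<^sub>L R = A'"
      "\<And>C. C o\<^sub>L A' = A' o\<^sub>L C \<Longrightarrow> C o\<^sub>L R = R o\<^sub>L C" by blast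
  let ?R = "sqrt c *\<^sub>R R"
  have "?R o\<^sub>L ?R = (sqrt c * sqrt c) *\<^sub>R (R o\<^sub>L R)"
    by (simp only: blinfun_compose.scaleR_left blinfun_compose.scaleR_right scaleR_scaleR)
  then have "?R o\<^sub>L ?R = A" using c by (simp add: R(3) A'_def)
  moreover have "C o\<^sub>L ?R = ?R o\<^sub>L C" if "C o\<^sub>L A = A o\<^sub>L C" for C
    using R(4)[of C] that by (simp add: A'_def blinfun_compose.scaleR_left blinfun_compose.scaleR_right)
  moreover have "0 \<le> ?R v \<bullet>\<^sub>R v" for v using R(2) c by (simp add: blinfun.scaleR_left rinner.scaleR_left)
  ultimately show ?thesis using symmetric_op_lincomb(3)[OF R(1)] by blast
qed

text \<open>By commutation (R + y) (R - y) = 0. On \<open>w = R v - y v\<close> the two nonnegative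
  forms therefore sum to 0, so \<open>R w = y w = 0\<close>, and by symmetry \<open>w\<close> is
  orthogonal to itself.\<close>

lemma positive_sqrt_unique:
  fixes R y :: "'h::complex_hilbert_space operator"
  assumes R: "symmetric_op R" "\<And>v. 0 \<le> R v \<bullet>\<^sub>R v" and y: "symmetric_op y" "\<And>v. 0 \<le> y v \<bullet>\<^sub>R v"
    and comm: "R o\<^sub>L y = y o\<^sub>L R" and sq: "R o\<^sub>L R = y o\<^sub>L y"
  shows "R = y"
proof (rule blinfun_eqI)
  fix v
  define w where "w = R v - y v"
  have c: "R (y u) = y (R u)" "R (R u) = y (y u)" for u
    using comm sq by (simp_all add: blinfun_compose_eq_iff)
  have "R w + y w = 0" by (simp add: w_def blinfun.diff_right c)
  then have "R w \<bullet>\<^sub>R w + y w \<bullet>\<^sub>R w = 0" by (simp add: rinner.zero_left flip: rinner.add_left)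
  then have "R w \<bullet>\<^sub>R w = 0" "y w \<bullet>\<^sub>R w = 0" using R(2)[of w] y(2)[of w] by linarith+
  then have "R w = 0" "y w = 0"
    using positive_form_eq_0 R y by blast+
  then have "w \<bullet>\<^sub>R w = 0"
    using R(1) y(1) unfolding w_def
    by (metis (no_types, lifting) diff_self rinner.diff_left rinner.zero_right symmetric_opD)
  then show "R v = y v" by (simp add: rinner_self w_def)
qed

section \<open>Lower spectral projections\<close>

lemma symmetric_projection_exists:
  fixes C :: "'h::complex_hilbert_space set"
  assumes "subspace C" "closed C"
  shows "\<exists>P::'h operator. symmetric_op P \<and> (\<forall>v. P v \<in> C) \<and> (\<forall>v\<in>C. P v = v)"
proof -
  obtain P :: "'h operator" where P: "\<And>v. P v \<in> C" "\<And>v w. w \<in> C \<Longrightarrow> (v - P v) \<bullet>\<^sub>R w = 0"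
    using orthogonal_projection_exists[OF assms] by blast
  have "P u \<bullet>\<^sub>R v = u \<bullet>\<^sub>R P v" for u v
    using P(2)[OF P(1), of u v] P(2)[OF P(1), of v u]
    by (simp add: rinner.diff_left) (metis rinner_commute)
  moreover have "P v = v" if "v \<in> C" for v
  proof -
    have "v - P v \<in> C" using assms(1) that P(1) by (rule subspace_diff)
    then have "(v - P v) \<bullet>\<^sub>R (v - P v) = 0" by (rule P(2))
    then show ?thesis by (simp add: rinner_self)
  qed
  ultimately show ?thesis using P(1) by (auto simp: symmetric_op_def)
qed

text \<open>Invariance of the range under X says P X P = X P; invariance under the adjoint Y says P
  Y P = Y P, whose adjoint is P X P = P X.\<close>

lemma commute_symmetric_projection:
  fixes P X Y :: "'h::complex_hilbert_space operator"
  assumes P: "symmetric_op P" and adj: "\<And>u v. X u \<bullet>\<^sub>R v = u \<bullet>\<^sub>R Y v"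
    and inv: "\<And>v. P (X (P v)) = X (P v)" "\<And>v. P (Y (P v)) = Y (P v)"
  shows "X o\<^sub>L P = P o\<^sub>L X"
  unfolding blinfun_compose_eq_iff
proof (intro allI rinner_eqI)
  fix v u
  have "u \<bullet>\<^sub>R P (X v) = X v \<bullet>\<^sub>R P u" by (simp add: rinner_commute flip: symmetric_opD[OF P])
  also have "\<dots> = v \<bullet>\<^sub>R P (Y (P u))" by (simp add: adj inv)
  also have "\<dots> = P v \<bullet>\<^sub>R Y (P u)" by (simp add: symmetric_opD[OF P])
  also have "\<dots> = X (P v) \<bullet>\<^sub>R P u" by (simp add: adj)
  also have "\<dots> = P (X (P v)) \<bullet>\<^sub>R u" by (simp only: symmetric_opD[OF P])
  also have "\<dots> = u \<bullet>\<^sub>R X (P v)" by (simp add: inv rinner_commute)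
  finally show "u \<bullet>\<^sub>R X (P v) = u \<bullet>\<^sub>R P (X v)" by simp
qed

lemma symmetric_op_eqI:
  assumes A: "symmetric_op A" and B: "symmetric_op B" and eq: "\<And>v. A v \<bullet>\<^sub>R v = B v \<bullet>\<^sub>R v"
  shows "A = B"
proof (intro blinfun_eqI rinner_eqI)
  fix u v
  have "A (u + v) \<bullet>\<^sub>R (u + v) = B (u + v) \<bullet>\<^sub>R (u + v)" by (rule eq)
  then have "A u \<bullet>\<^sub>R v + A v \<bullet>\<^sub>R u = B u \<bullet>\<^sub>R v + B v \<bullet>\<^sub>R u"
    by (simp add: blinfun.add_right rinner.add_left rinner.add_right eq)
  then show "u \<bullet>\<^sub>R A v = u \<bullet>\<^sub>R B v"
    by (simp add: symmetric_opD[OF A] symmetric_opD[OF B] rinner_commute[of v] )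
qed

text \<open>The strict inequality on the kernel makes \<open>P\<close> the projection of \<open>(-\<infinity>, t]\<close> rather than
  that of \<open>(-\<infinity>, t)\<close>, and thereby unique.\<close>

definition lower_spectral_projection ::
    "'h::complex_hilbert_space operator \<Rightarrow> real \<Rightarrow> 'h operator \<Rightarrow> bool" where
  "lower_spectral_projection T t P \<longleftrightarrow>
     symmetric_op P \<and> P o\<^sub>L P = P \<and> T o\<^sub>L P = P o\<^sub>L T \<and>
     (\<forall>v. P v = v \<longrightarrow> T v \<bullet>\<^sub>R v \<le> t * (norm v)\<^sup>2) \<and>
     (\<forall>v. P v = 0 \<longrightarrow> v \<noteq> 0 \<longrightarrow> t * (norm v)\<^sup>2 < T v \<bullet>\<^sub>R v)"

text \<open>With \<open>S = T - t\<close>, the projection is the one onto the kernel of \<open>\<bar>S\<bar> + S\<close>.\<close>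

lemma lower_spectral_projection_exists:
  fixes T :: "'h::complex_hilbert_space operator"
  assumes T: "symmetric_op T"
  shows "\<exists>P. lower_spectral_projection T t P \<and> (\<forall>C. C o\<^sub>L T = T o\<^sub>L C \<longrightarrow> C o\<^sub>L P = P o\<^sub>L C)"
proof -
  define S where "S = T - t *\<^sub>R id_blinfun"
  have Sv: "S v = T v - t *\<^sub>R v" for v by (simp add: S_def blinfun.diff_left blinfun.scaleR_left)
  have S: "symmetric_op S" unfolding S_def by (intro symmetric_op_lincomb T)
  have "0 \<le> (S o\<^sub>L S) v \<bullet>\<^sub>R v" for v by (simp add: symmetric_opD[OF S] rinner_self)
  from positive_sqrt_exists[OF symmetric_op_compose[OF S S refl] this]
  obtain R where R: "symmetric_op R" "\<And>v. 0 \<le> R v \<bullet>\<^sub>R v" "R o\<^sub>L R = S o\<^sub>L S"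
    and R_comm: "\<And>C. C o\<^sub>L (S o\<^sub>L S) = (S o\<^sub>L S) o\<^sub>L C \<Longrightarrow> C o\<^sub>L R = R o\<^sub>L C" by blast
  have "S o\<^sub>L R = R o\<^sub>L S" by (rule R_comm) (simp add: blinfun_compose_eq_iff)
  then have RS: "S (R v) = R (S v)" and RR: "R (R v) = S (S v)" for v
    using R(3) by (simp_all add: blinfun_compose_eq_iff)
  define N where "N = R + S"
  have Nv: "N v = R v + S v" for v by (simp add: N_def blinfun.add_left)
  have N: "symmetric_op N" unfolding N_def by (intro symmetric_op_lincomb R S)
  define C where "C = {v. N v = 0}"
  have "subspace C" by (auto simp: C_def subspace_def blinfun.add_right blinfun.scaleR_right blinfun.zero_right)
  moreover have "closed C" unfolding C_def
    by (intro closed_Collect_eq continuous_intros)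
  ultimately obtain P :: "'h operator" where
    P: "symmetric_op P" "\<And>v. P v \<in> C" "\<And>v. v \<in> C \<Longrightarrow> P v = v"
    using symmetric_projection_exists by blast
  have comm: "X o\<^sub>L P = P o\<^sub>L X" if X: "X o\<^sub>L T = T o\<^sub>L X" for X
  proof -
    \<comment> \<open>\<open>X\<close> need not be symmetric, so the kernel \<open>C\<close> must be
      shown invariant under its adjoint as well.\<close>
    obtain Y :: "'h operator" where Y: "\<And>u v. X u \<bullet>\<^sub>R v = u \<bullet>\<^sub>R Y v" using real_adjoint_exists[of X] by blast
    have XS: "X (S v) = S (X v)" for v
      using X by (simp add: Sv blinfun_compose_eq_iff blinfun.diff_right blinfun.scaleR_right)
    then have "X o\<^sub>L R = R o\<^sub>L X" by (intro R_comm) (simp add: blinfun_compose_eq_iff)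
    then have XN: "X (N v) = N (X v)" for v
      by (simp add: Nv XS blinfun.add_right blinfun_compose_eq_iff)
    have YN: "Y (N v) = N (Y v)" for v
      by (rule rinner_eqI) (simp add: XN flip: Y symmetric_opD[OF N])
    show ?thesis
    proof (rule commute_symmetric_projection[OF P(1) Y])
      have "N (P v) = 0" for v using P(2) by (simp add: C_def)
      then show "P (X (P v)) = X (P v)" "P (Y (P v)) = Y (P v)" for v
        by (auto intro!: P(3) simp: C_def blinfun.zero_right simp flip: XN YN)
    qed
  qed
  have "P o\<^sub>L P = P" using P by (intro blinfun_eqI) simp
  moreover have "T v \<bullet>\<^sub>R v \<le> t * (norm v)\<^sup>2" if "P v = v" for v
  proof -
    have "N v = 0" using P(2)[of v] that by (simp add: C_def)
    then have "R v \<bullet>\<^sub>R v + S v \<bullet>\<^sub>R v = 0" by (simp add: Nv rinner.zero_left flip: rinner.add_left)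
    then show ?thesis using R(2)[of v] by (simp add: Sv rinner.diff_left rinner.scaleR_left rinner_self)
  qed
  moreover have "t * (norm v)\<^sup>2 < T v \<bullet>\<^sub>R v" if v: "P v = 0" "v \<noteq> 0" for v
  proof -
    \<comment> \<open>R - S maps into the kernel of N = R + S because R^2 = S^2. A vector killed by
      \<open>P\<close> is orthogonal to that kernel, so R and S agree on it.\<close>
    have "u \<bullet>\<^sub>R (R v - S v) = u \<bullet>\<^sub>R 0" for u
    proof -
      have "R u - S u \<in> C" by (simp add: C_def Nv blinfun.diff_right RS RR)
      then have "(R u - S u) \<bullet>\<^sub>R v = P (R u - S u) \<bullet>\<^sub>R v" by (simp add: P(3))
      also have "\<dots> = 0" using P(1) v by (simp add: symmetric_opD rinner.zero_right)
      finally show ?thesis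
        using R(1) S by (simp add: rinner.diff_left rinner.diff_right symmetric_opD rinner.zero_right)
    qed
    then have eq: "R v = S v" using rinner_eqI[of "R v - S v" 0] by simp
    have "S v \<bullet>\<^sub>R v \<noteq> 0"
    proof
      assume "S v \<bullet>\<^sub>R v = 0"
      then have "R v = 0" using positive_form_eq_0[OF R(1,2), of v] eq by simp
      then have "v \<in> C" using eq by (simp add: C_def Nv)
      then show False using P(3) v by simp
    qed
    with R(2)[of v] eq have "0 < S v \<bullet>\<^sub>R v" by simp
    then show ?thesis by (simp add: Sv rinner.diff_left rinner.scaleR_left rinner_self)
  qed
  ultimately have "lower_spectral_projection T t P"
    using P(1) comm[OF refl] by (auto simp: lower_spectral_projection_def)
  then show ?thesis using comm by blast
qed

text \<open>\<open>w = P (1 - Q) v\<close> lies in the range of \<open>P\<close> and, by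
  commutation, in the kernel of \<open>Q\<close>. The upper bound at \<open>s\<close> and the strict
  lower bound at \<open>t\<close> are compatible only for \<open>w = 0\<close>.\<close>

lemma lower_spectral_projection_mono:
  assumes P: "lower_spectral_projection T s P" and Q: "lower_spectral_projection T t Q"
    and st: "s \<le> t" and comm: "P o\<^sub>L Q = Q o\<^sub>L P"
  shows "P o\<^sub>L Q = P"
proof (rule blinfun_eqI)
  fix v
  define w where "w = P v - P (Q v)"
  have PP: "P (P u) = P u" and QQ: "Q (Q u) = Q u" and PQ: "P (Q u) = Q (P u)" for u
    using P Q comm unfolding lower_spectral_projection_def by (metis blinfun_apply_blinfun_compose)+
  have "P w = w" by (simp add: w_def blinfun.diff_right PP)
  then have "T w \<bullet>\<^sub>R w \<le> s * (norm w)\<^sup>2" using P by (simp add: lower_spectral_projection_def)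
  also have "\<dots> \<le> t * (norm w)\<^sup>2" using st by (rule mult_right_mono) simp
  finally have "\<not> t * (norm w)\<^sup>2 < T w \<bullet>\<^sub>R w" by simp
  moreover have "Q w = 0" by (simp add: w_def blinfun.diff_right PQ QQ)
  ultimately have "w = 0" using Q unfolding lower_spectral_projection_def by blast
  then show "(P o\<^sub>L Q) v = P v" by (simp add: w_def)
qed

text \<open>Monotonicity applies in both directions. In its use below one of the two projections is
  \<open>F t\<close>, which commutes with everything that commutes with \<open>T\<close>, and so
  with the other projection.\<close>

lemma lower_spectral_projection_unique:
  assumes "lower_spectral_projection T t P" "lower_spectral_projection T t Q" "P o\<^sub>L Q = Q o\<^sub>L P"
  shows "P = Q"
  using lower_spectral_projection_mono[OF assms(1,2) order_refl assms(3)]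
    lower_spectral_projection_mono[OF assms(2,1) order_refl assms(3)[symmetric]] assms(3) by simp

section \<open>The absolute value\<close>

lemma scale_op_id_apply [simp]: "scale_op c id_blinfun v = c *\<^sub>C v"
  by (simp add: scale_op.rep_eq)

lemma bounded_operators_iff_commute:
  "T \<in> bounded_operators \<longleftrightarrow> (\<forall>c. scale_op c id_blinfun o\<^sub>L T = T o\<^sub>L scale_op c id_blinfun)"
  by (auto simp: bounded_operators_def blinfun_compose_eq_iff)

lemma op_abs_of_self_adjoint:
  assumes T: "self_adjoint T"
  shows "positive_op (op_abs T)" "op_abs T o\<^sub>L op_abs T = T o\<^sub>L T"
    "C o\<^sub>L T = T o\<^sub>L C \<Longrightarrow> C o\<^sub>L op_abs T = op_abs T o\<^sub>L C"
proof -
  have symT: "symmetric_op T" and bT: "T \<in> bounded_operators" and adj: "op_adjoint T = T"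
    using T self_adjoint_iff self_adjoint_def by blast+
  have "0 \<le> (T o\<^sub>L T) v \<bullet>\<^sub>R v" for v by (simp add: symmetric_opD[OF symT] rinner_self)
  from positive_sqrt_exists[OF symmetric_op_compose[OF symT symT refl] this]
  obtain R where R: "symmetric_op R" "\<And>v. 0 \<le> R v \<bullet>\<^sub>R v" "R o\<^sub>L R = T o\<^sub>L T"
    and R_comm: "\<And>C. C o\<^sub>L (T o\<^sub>L T) = (T o\<^sub>L T) o\<^sub>L C \<Longrightarrow> C o\<^sub>L R = R o\<^sub>L C" by blast
  have comm: "C o\<^sub>L R = R o\<^sub>L C" if "C o\<^sub>L T = T o\<^sub>L C" for C
    using that by (intro R_comm) (simp add: blinfun_compose_eq_iff)
  have "R \<in> bounded_operators"
    using bT comm by (simp add: bounded_operators_iff_commute)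
  then have pos: "positive_op R" using R by (simp add: positive_op_iff self_adjoint_iff)
  have "op_abs T = R"
    unfolding op_abs_def adj
  proof (rule the_equality)
    show "positive_op R \<and> R o\<^sub>L R = T o\<^sub>L T" using pos R by blast
    fix y :: "'a operator" assume y: "positive_op y \<and> y o\<^sub>L y = T o\<^sub>L T"
    then have y': "symmetric_op y" "\<And>v. 0 \<le> y v \<bullet>\<^sub>R v" "y o\<^sub>L y = R o\<^sub>L R"
      by (auto simp: positive_op_iff self_adjoint_iff R(3))
    \<comment> \<open>Any competing root \<open>y\<close> commutes with its own square, hence with
      \<open>R\<close>; this supplies the commutation that uniqueness of the root asks for.\<close>
    have "y o\<^sub>L (y o\<^sub>L y) = (y o\<^sub>L y) o\<^sub>L y" by (simp add: blinfun_compose_eq_iff)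
    then have "y o\<^sub>L R = R o\<^sub>L y" using y by (intro R_comm) simp
    then show "y = R" by (rule positive_sqrt_unique[OF y'(1,2) R(1,2) _ y'(3)])
  qed
  then show "positive_op (op_abs T)" "op_abs T o\<^sub>L op_abs T = T o\<^sub>L T"
    "C o\<^sub>L T = T o\<^sub>L C \<Longrightarrow> C o\<^sub>L op_abs T = op_abs T o\<^sub>L C"
    using pos R(3) comm by blast+
qed

lemma norm_op_abs:
  assumes "self_adjoint T"
  shows "norm (op_abs T v) = norm (T v)"
proof -
  have "symmetric_op (op_abs T)" "symmetric_op T"
    using op_abs_of_self_adjoint(1)[OF assms] assms by (auto simp: positive_op_iff self_adjoint_iff)
  moreover have "op_abs T (op_abs T v) = T (T v)"
    using op_abs_of_self_adjoint(2)[OF assms] by (simp add: blinfun_compose_eq_iff)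
  ultimately have "(norm (op_abs T v))\<^sup>2 = (norm (T v))\<^sup>2"
    by (simp add: symmetric_opD flip: rinner_self)
  then show ?thesis by (simp add: power2_eq_iff_nonneg)
qed

section \<open>Existence of the spectral measure\<close>

text \<open>The case \<open>m = n\<close> of the absorption hypothesis is idempotence. Increments
  are orthogonal, so their squared norms are differences of a bounded increasing real sequence, and
  Cauchyness transfers from the reals to the vectors.\<close>

lemma increasing_projections_converge:
  fixes Q :: "nat \<Rightarrow> 'h::complex_hilbert_space operator"
  assumes sym: "\<And>n. symmetric_op (Q n)" and abs: "\<And>m n v. m \<le> n \<Longrightarrow> Q n (Q m v) = Q m v"
  shows "\<exists>L. symmetric_op L \<and> L o\<^sub>L L = L \<and> (\<forall>v. (\<lambda>n. Q n v) \<longlonglongrightarrow> L v)"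
proof -
  have abs': "Q m (Q n v) = Q m v" if "m \<le> n" for m n v
    by (rule rinner_eqI) (simp add: abs that flip: symmetric_opD[OF sym])
  have diff: "(norm (Q n v - Q m v))\<^sup>2 = (norm (Q n v))\<^sup>2 - (norm (Q m v))\<^sup>2" if "m \<le> n" for m n v
  proof -
    have "Q n v \<bullet>\<^sub>R Q m v = v \<bullet>\<^sub>R Q m v" by (simp add: symmetric_opD[OF sym] abs[OF that])
    also have "\<dots> = Q m v \<bullet>\<^sub>R Q m v" by (simp add: symmetric_opD[OF sym] abs)
    finally show ?thesis by (simp add: norm_diff_square rinner_self)
  qed
  have bound: "norm (Q n v) \<le> norm v" for n v
  proof -
    have "(norm (Q n v))\<^sup>2 = v \<bullet>\<^sub>R Q n v" by (simp add: symmetric_opD[OF sym] abs flip: rinner_self)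
    also have "\<dots> \<le> norm v * norm (Q n v)" using rinner_Cauchy_Schwarz abs_le_D1 by blast
    finally show ?thesis by (cases "Q n v = 0") (simp_all add: power2_eq_square)
  qed
  have "convergent (\<lambda>n. Q n v)" for v
  proof -
    let ?g = "\<lambda>n. (norm (Q n v))\<^sup>2"
    have "incseq ?g"
      using diff[of _ _ v] by (intro incseq_SucI) (metis diff_ge_0_iff_ge le_SucI order_refl zero_le_power2)
    moreover have "Bseq ?g"
      using bound[of _ v] by (intro BseqI'[where K = "(norm v)\<^sup>2"]) (simp add: power_mono)
    ultimately have "convergent ?g" by (simp add: Bseq_mono_convergent incseq_def)
    then have g: "Cauchy ?g" by (rule convergent_Cauchy)
    have "Cauchy (\<lambda>n. Q n v)"
    proof (rule metric_CauchyI)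
      fix e :: real assume e: "0 < e"
      then obtain N where N: "\<And>m n. N \<le> m \<Longrightarrow> N \<le> n \<Longrightarrow> dist (?g m) (?g n) < e\<^sup>2"
        using metric_CauchyD[OF g, of "e\<^sup>2"] by auto
      have "dist (Q m v) (Q n v) < e" if "N \<le> m" "N \<le> n" for m n
      proof -
        have "(norm (Q m v - Q n v))\<^sup>2 \<le> dist (?g m) (?g n)"
          using diff[of m n v] diff[of n m v] by (cases "m \<le> n") (auto simp: dist_real_def norm_minus_commute)
        also have "\<dots> < e\<^sup>2" using N that by blast
        finally show ?thesis using e by (simp add: dist_norm power_less_imp_less_base)
      qed
      then show "\<exists>M. \<forall>m\<ge>M. \<forall>n\<ge>M. dist (Q m v) (Q n v) < e" by blast
    qed
    then show ?thesis by (simp add: Cauchy_convergent_iff)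
  qed
  then obtain l where l: "\<And>v. (\<lambda>n. Q n v) \<longlonglongrightarrow> l v" unfolding convergent_def by metis
  have "bounded_linear l"
  proof (rule bounded_linear_intro[where K = 1])
    show "l (u + v) = l u + l v" for u v
      using tendsto_add[OF l[of u] l[of v]] l[of "u + v"] by (simp add: blinfun.add_right LIMSEQ_unique)
    show "l (r *\<^sub>R v) = r *\<^sub>R l v" for r v
      using tendsto_scaleR[OF tendsto_const[of r] l[of v]] l[of "r *\<^sub>R v"]
      by (simp add: blinfun.scaleR_right LIMSEQ_unique)
    show "norm (l v) \<le> norm v * 1" for v
      using bound by (intro LIMSEQ_le_const2[OF tendsto_norm[OF l]]) simp
  qed
  then have L: "Blinfun l v = l v" for v by (simp add: bounded_linear_Blinfun_apply)
  \<comment> \<open>Every \<open>Q m\<close> absorbs the limit; letting \<open>m\<close> grow gives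
    idempotence of the limit.\<close>
  have Ql: "Q m (l v) = Q m v" for m v
  proof -
    have "(\<lambda>n. Q m (Q n v)) \<longlonglongrightarrow> Q m (l v)" by (intro blinfun.tendsto tendsto_const l)
    moreover have "(\<lambda>n. Q m (Q n v)) \<longlonglongrightarrow> Q m v"
      by (rule tendsto_eventually) (auto simp: eventually_sequentially abs' intro!: exI[of _ m])
    ultimately show ?thesis by (rule LIMSEQ_unique)
  qed
  have "symmetric_op (Blinfun l)"
    unfolding symmetric_op_def L
  proof (intro allI)
    fix u v
    have "(\<lambda>n. Q n u \<bullet>\<^sub>R v) \<longlonglongrightarrow> l u \<bullet>\<^sub>R v" "(\<lambda>n. u \<bullet>\<^sub>R Q n v) \<longlonglongrightarrow> u \<bullet>\<^sub>R l v"
      by (intro rinner.tendsto l tendsto_const)+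
    then show "l u \<bullet>\<^sub>R v = u \<bullet>\<^sub>R l v" by (simp add: symmetric_opD[OF sym] LIMSEQ_unique)
  qed
  moreover have "Blinfun l o\<^sub>L Blinfun l = Blinfun l"
  proof (rule blinfun_eqI)
    show "(Blinfun l o\<^sub>L Blinfun l) v = Blinfun l v" for v
      using l[of "l v"] l[of v] by (simp add: L Ql LIMSEQ_unique)
  qed
  ultimately show ?thesis using l by (auto simp: L)
qed

lemma symmetric_idempotent_form:
  "symmetric_op P \<Longrightarrow> P o\<^sub>L P = P \<Longrightarrow> P v \<bullet>\<^sub>R v = (norm (P v))\<^sup>2"
  by (metis blinfun_apply_blinfun_compose rinner_self symmetric_opD)

text \<open>A Riemann-Stieltjes argument in disguise: over \<open>n + 1\<close> equal steps the
  bounds telescope in \<open>f\<close> to the total \<open>(b - a) * (f b - f a)\<close> divided by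
  \<open>n + 1\<close>, which tends to 0.\<close>

lemma vanishing_increment_quotient_imp_eq:
  fixes D f :: "real \<Rightarrow> real"
  assumes bound: "\<And>s t. s \<le> t \<Longrightarrow> \<bar>D t - D s\<bar> \<le> (t - s) * (f t - f s)" and ab: "a \<le> b"
  shows "D a = D b"
proof -
  have step: "\<bar>D b - D a\<bar> \<le> inverse (real (Suc n)) * ((b - a) * (f b - f a))" for n
  proof -
    define h where "h = (b - a) / real (Suc n)"
    define x where "x i = a + real i * h" for i
    have h: "0 \<le> h" using ab by (simp add: h_def)
    have x: "x 0 = a" "x (Suc n) = b" by (simp_all add: x_def h_def del: of_nat_Suc)
    have "\<bar>D b - D a\<bar> = \<bar>\<Sum>i<Suc n. D (x (Suc i)) - D (x i)\<bar>"
      using sum_lessThan_telescope[of "\<lambda>i. D (x i)" "Suc n"] by (simp only: x)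
    also have "\<dots> \<le> (\<Sum>i<Suc n. \<bar>D (x (Suc i)) - D (x i)\<bar>)" by (rule sum_abs)
    also have "\<dots> \<le> (\<Sum>i<Suc n. h * (f (x (Suc i)) - f (x i)))"
    proof (rule sum_mono)
      fix i
      show "\<bar>D (x (Suc i)) - D (x i)\<bar> \<le> h * (f (x (Suc i)) - f (x i))"
        using bound[of "x i" "x (Suc i)"] h by (simp add: x_def algebra_simps)
    qed
    also have "\<dots> = h * (f b - f a)"
      using sum_lessThan_telescope[of "\<lambda>i. f (x i)" "Suc n"] by (simp only: sum_distrib_left[symmetric] x)
    finally show ?thesis by (simp add: h_def field_simps del: of_nat_Suc)
  qed
  have "(\<lambda>n. inverse (real (Suc n)) * ((b - a) * (f b - f a))) \<longlonglongrightarrow> 0 * ((b - a) * (f b - f a))"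
    by (intro tendsto_mult LIMSEQ_inverse_real_of_nat tendsto_const)
  then have "\<bar>D b - D a\<bar> \<le> 0"
    using step by (intro LIMSEQ_le_const) auto
  then show ?thesis by simp
qed

section \<open>The resolution of the identity of a symmetric operator\<close>

locale spectral_family =
  fixes T :: "'h::complex_hilbert_space operator" and F :: "real \<Rightarrow> 'h operator"
  assumes symmetric: "symmetric_op T"
    and lower: "lower_spectral_projection T t (F t)"
    and commute: "C o\<^sub>L T = T o\<^sub>L C \<Longrightarrow> C o\<^sub>L F t = F t o\<^sub>L C"
begin

lemma F_symmetric: "symmetric_op (F t)"
  and F_idem: "F t o\<^sub>L F t = F t"
  and F_T: "T (F t v) = F t (T v)"
  and F_upper: "F t v = v \<Longrightarrow> T v \<bullet>\<^sub>R v \<le> t * (norm v)\<^sup>2"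
  and F_lower: "F t v = 0 \<Longrightarrow> v \<noteq> 0 \<Longrightarrow> t * (norm v)\<^sup>2 < T v \<bullet>\<^sub>R v"
  using lower[of t] by (simp_all add: lower_spectral_projection_def blinfun_compose_eq_iff)

lemma F_F: "s \<le> t \<Longrightarrow> F s (F t v) = F s v" "s \<le> t \<Longrightarrow> F t (F s v) = F s v"
proof -
  have comm: "F s o\<^sub>L F t = F t o\<^sub>L F s"
    using lower[of s] by (intro commute) (simp add: lower_spectral_projection_def)
  assume "s \<le> t"
  from lower_spectral_projection_mono[OF lower lower this comm]
  show "F s (F t v) = F s v" "F t (F s v) = F s v"
    using comm by (metis blinfun_apply_blinfun_compose)+
qed

lemma F_F_same: "F t (F t v) = F t v"
  by (simp add: F_F)

lemma abs_T_form_le: "\<bar>T v \<bullet>\<^sub>R v\<bar> \<le> norm T * (norm v)\<^sup>2"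
proof -
  have "\<bar>T v \<bullet>\<^sub>R v\<bar> \<le> norm (T v) * norm v" by (rule rinner_Cauchy_Schwarz)
  also have "\<dots> \<le> (norm T * norm v) * norm v" by (intro mult_right_mono norm_blinfun) simp
  finally show ?thesis by (simp add: power2_eq_square)
qed

text \<open>Strict here but not in \<open>F_high\<close>: \<open>F t\<close> belongs to the closed
  half line up to \<open>t\<close>, so the point \<open>- norm T\<close> may itself carry
  spectrum.\<close>

lemma F_low: "t < - norm T \<Longrightarrow> F t v = 0"
proof (rule ccontr)
  assume t: "t < - norm T" and nz: "F t v \<noteq> 0"
  have "T (F t v) \<bullet>\<^sub>R F t v \<le> t * (norm (F t v))\<^sup>2" by (rule F_upper) (rule F_F_same)
  moreover have "- (norm T * (norm (F t v))\<^sup>2) \<le> T (F t v) \<bullet>\<^sub>R F t v"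
    using abs_T_form_le[of "F t v"] by simp
  ultimately have "0 \<le> (t + norm T) * (norm (F t v))\<^sup>2" by (simp add: algebra_simps)
  then show False using t nz by (simp add: zero_le_mult_iff)
qed

lemma F_high: "norm T \<le> t \<Longrightarrow> F t v = v"
proof (rule ccontr)
  assume t: "norm T \<le> t" and nz: "F t v \<noteq> v"
  define w where "w = v - F t v"
  have "F t w = 0" by (simp add: w_def blinfun.diff_right F_F_same)
  moreover have "w \<noteq> 0" using nz by (simp add: w_def)
  ultimately have "t * (norm w)\<^sup>2 < T w \<bullet>\<^sub>R w" by (rule F_lower)
  also have "\<dots> \<le> norm T * (norm w)\<^sup>2" using abs_T_form_le[of w] by simp
  also have "\<dots> \<le> t * (norm w)\<^sup>2" using t by (rule mult_right_mono) simp
  finally show False by simp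
qed

definition dist_fun :: "'h \<Rightarrow> real \<Rightarrow> real" where
  "dist_fun v t = F t v \<bullet>\<^sub>R v"

lemma dist_fun_eq: "dist_fun v t = (norm (F t v))\<^sup>2"
  unfolding dist_fun_def by (rule symmetric_idempotent_form[OF F_symmetric F_idem])

lemma norm_F_diff:
  assumes "s \<le> t"
  shows "(norm (F t v - F s v))\<^sup>2 = dist_fun v t - dist_fun v s"
proof -
  have "F t v \<bullet>\<^sub>R F s v = F s v \<bullet>\<^sub>R F s v"
    using assms by (simp add: symmetric_opD[OF F_symmetric] F_F F_F_same)
  then show ?thesis by (simp add: norm_diff_square dist_fun_eq rinner_self)
qed

lemma dist_fun_mono: "s \<le> t \<Longrightarrow> dist_fun v s \<le> dist_fun v t"
  using norm_F_diff[of s t v] by (metis diff_ge_0_iff_ge zero_le_power2)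

text \<open>Right continuity is where the strict inequality in the definition of a lower spectral
  projection enters: the jump vector at \<open>t\<close> satisfies \<open>\<langle>Tw, w\<rangle> \<le> t \<parallel>w\<parallel>\<^sup>2\<close> and \<open>F t w = 0\<close>.\<close>

lemma dist_fun_right_cont: "continuous (at_right t) (dist_fun v)"
  unfolding continuous_within
proof (rule tendsto_at_right_sequentially)
  show "t < t + 1" by simp
  fix S :: "nat \<Rightarrow> real"
  assume S: "\<And>n. t < S n" "decseq S" "S \<longlonglongrightarrow> t"
  \<comment> \<open>The \<open>F (S n)\<close> decrease, so convergence is taken from their
    increasing complements.\<close>
  define Q where "Q n = id_blinfun - F (S n)" for n
  have Qv: "Q n u = u - F (S n) u" for n u by (simp add: Q_def blinfun.diff_left)
  have "symmetric_op (Q n)" for n unfolding Q_def by (intro symmetric_op_lincomb F_symmetric)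
  moreover have "Q n (Q m u) = Q m u" if "m \<le> n" for m n u
    using decseqD[OF S(2) that] by (simp add: Qv blinfun.diff_right F_F)
  ultimately obtain L where L: "\<And>u. (\<lambda>n. Q n u) \<longlonglongrightarrow> L u"
    using increasing_projections_converge by blast
  define l where "l = v - L v"
  have l: "(\<lambda>n. F (S n) v) \<longlonglongrightarrow> l"
    using tendsto_diff[OF tendsto_const[of v] L[of v]] by (simp add: Qv l_def)
  define w where "w = l - F t v"
  have "F (S m) l = l" for m
  proof -
    have "(\<lambda>n. F (S m) (F (S n) v)) \<longlonglongrightarrow> F (S m) l" by (intro blinfun.tendsto tendsto_const l)
    moreover have "\<forall>\<^sub>F n in sequentially. F (S m) (F (S n) v) = F (S n) v"
      using decseqD[OF S(2)] by (auto simp: eventually_sequentially F_F intro!: exI[of _ m])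
    ultimately have "(\<lambda>n. F (S n) v) \<longlonglongrightarrow> F (S m) l" by (rule Lim_transform_eventually)
    then show ?thesis using l LIMSEQ_unique by blast
  qed
  then have "F (S m) w = w" for m
    using S(1)[of m] by (simp add: w_def blinfun.diff_right F_F)
  then have "T w \<bullet>\<^sub>R w \<le> S m * (norm w)\<^sup>2" for m by (rule F_upper)
  then have "T w \<bullet>\<^sub>R w \<le> t * (norm w)\<^sup>2"
    by (intro LIMSEQ_le_const[OF tendsto_mult[OF S(3) tendsto_const]]) auto
  moreover have "F t w = 0"
  proof -
    have "(\<lambda>n. F t (F (S n) v)) \<longlonglongrightarrow> F t l" by (intro blinfun.tendsto tendsto_const l)
    then have "F t l = F t v" using S(1) by (simp add: F_F less_imp_le LIMSEQ_const_iff)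
    then show ?thesis by (simp add: w_def blinfun.diff_right F_F_same)
  qed
  ultimately have "w = 0" using F_lower[of t w] by auto
  then have "l = F t v" by (simp add: w_def)
  with l have "(\<lambda>n. F (S n) v \<bullet>\<^sub>R v) \<longlonglongrightarrow> F t v \<bullet>\<^sub>R v" by (intro rinner.tendsto tendsto_const) simp
  then show "(\<lambda>n. dist_fun v (S n)) \<longlonglongrightarrow> dist_fun v t" by (simp add: dist_fun_def)
qed

section \<open>Stieltjes measures and the projections of Borel sets\<close>

definition mu :: "'h \<Rightarrow> real measure" where
  "mu v = interval_measure (dist_fun v)"

lemma sets_mu [simp, measurable_cong]: "sets (mu v) = sets borel"
  and space_mu [simp]: "space (mu v) = UNIV"
  by (simp_all add: mu_def)

lemma emeasure_mu_UNIV: "emeasure (mu v) UNIV = ennreal ((norm v)\<^sup>2)"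
  unfolding mu_def
proof (rule interval_measure_UNIV[OF dist_fun_mono dist_fun_right_cont])
  show "(dist_fun v \<longlongrightarrow> 0) at_bot"
    by (rule tendsto_eventually)
      (auto simp: eventually_at_bot_dense dist_fun_eq F_low intro!: exI[of _ "- norm T"])
  show "(dist_fun v \<longlongrightarrow> (norm v)\<^sup>2) at_top"
    by (rule tendsto_eventually)
      (auto simp: eventually_at_top_linorder dist_fun_eq F_high intro!: exI[of _ "norm T"])
qed simp_all

lemma finite_measure_mu: "finite_measure (mu v)"
  by (rule finite_measureI) (simp add: emeasure_mu_UNIV)

lemma measure_mu_UNIV: "measure (mu v) UNIV = (norm v)\<^sup>2"
  by (simp add: measure_def emeasure_mu_UNIV)

lemma measure_mu_Ioc: "a \<le> b \<Longrightarrow> measure (mu v) {a<..b} = dist_fun v b - dist_fun v a"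
  unfolding mu_def by (rule measure_interval_measure_Ioc[OF _ dist_fun_mono dist_fun_right_cont])

lemma measure_mu_support:
  assumes "norm T < K"
  shows "measure (mu v) {- K<..K} = (norm v)\<^sup>2"
proof -
  have "- K \<le> K" using assms norm_ge_zero[of T] by linarith
  then show ?thesis using assms by (simp add: measure_mu_Ioc dist_fun_eq F_high F_low)
qed

text \<open>The quadratic form determines a symmetric \<open>P\<close>. The clause on commuting
  operators is carried through the induction over Borel sets because it later gives complex
  linearity.\<close>

definition represents :: "'h operator \<Rightarrow> real set \<Rightarrow> bool" where
  "represents P B \<longleftrightarrow> symmetric_op P \<and> P o\<^sub>L P = P \<and>
     (\<forall>C. C o\<^sub>L T = T o\<^sub>L C \<longrightarrow> C o\<^sub>L P = P o\<^sub>L C) \<and> (\<forall>v. measure (mu v) B = P v \<bullet>\<^sub>R v)"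

lemma representsI:
  assumes "symmetric_op P" "\<And>v. P (P v) = P v"
    and "\<And>C v. C o\<^sub>L T = T o\<^sub>L C \<Longrightarrow> C (P v) = P (C v)" "\<And>v. measure (mu v) B = P v \<bullet>\<^sub>R v"
  shows "represents P B"
  using assms unfolding represents_def blinfun_compose_eq_iff
  by (metis blinfun_apply_blinfun_compose blinfun_eqI)

lemma represents_commute: "represents P B \<Longrightarrow> C o\<^sub>L T = T o\<^sub>L C \<Longrightarrow> C (P v) = P (C v)"
  unfolding represents_def by (metis blinfun_apply_blinfun_compose)

lemma represents_unique: "represents P B \<Longrightarrow> represents Q B \<Longrightarrow> P = Q"
  unfolding represents_def by (metis symmetric_op_eqI)

lemma represents_form: "represents P B \<Longrightarrow> measure (mu v) B = (norm (P v))\<^sup>2"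
  by (simp add: represents_def symmetric_idempotent_form)

lemma represents_idem: "represents P B \<Longrightarrow> P (P v) = P v"
  unfolding represents_def by (metis blinfun_apply_blinfun_compose)

text \<open>In the measure of \<open>Q v\<close> the set \<open>B\<close> already has the full mass,
  since \<open>Q\<close> fixes \<open>Q v\<close>; a disjoint \<open>A\<close> is left with mass 0,
  and that mass is the squared norm of \<open>P (Q v)\<close>.\<close>

lemma represents_disjoint:
  assumes P: "represents P A" and Q: "represents Q B" and "A \<inter> B = {}"
    and [measurable]: "A \<in> sets borel" "B \<in> sets borel"
  shows "P (Q v) = 0"
proof -
  interpret finite_measure "mu (Q v)" by (rule finite_measure_mu)
  have "measure (mu (Q v)) A + measure (mu (Q v)) B = measure (mu (Q v)) (A \<union> B)"
    using assms by (intro finite_measure_Union[symmetric]) auto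
  also have "\<dots> \<le> measure (mu (Q v)) UNIV" by (rule finite_measure_mono) auto
  finally have "(norm (P (Q v)))\<^sup>2 + (norm (Q v))\<^sup>2 \<le> (norm (Q v))\<^sup>2"
    by (simp add: represents_form[OF P] represents_form[OF Q] measure_mu_UNIV represents_idem[OF Q])
  then show ?thesis by simp
qed

text \<open>Disjointness makes the \<open>P i\<close> mutually orthogonal, so their partial sums are
  increasing projections and converge strongly.\<close>

lemma represents_countable_union:
  assumes rep: "\<And>i::nat. represents (P i) (A i)" and disj: "disjoint_family A"
    and meas: "range A \<subseteq> sets borel"
  shows "\<exists>L. represents L (\<Union>i. A i) \<and> (\<forall>v. (\<lambda>i. P i v) sums L v)"
proof -
  define Q where "Q n = (\<Sum>i<n. P i)" for n
  have Qv: "Q n v = (\<Sum>i<n. P i v)" for n v by (simp add: Q_def blinfun.sum_left)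
  have sym: "symmetric_op (Q n)" for n
    using rep by (simp add: symmetric_op_def Qv rinner.sum_left rinner.sum_right represents_def)
  have PP: "P i (P j v) = (if i = j then P j v else 0)" for i j v
    using represents_idem[OF rep] represents_disjoint[OF rep rep, of i j v] disj meas
    by (auto simp: disjoint_family_on_def)
  have "Q n (P j v) = P j v" if "j < n" for n j v
    using that by (simp add: Qv PP sum.delta)
  then have "Q n (Q m v) = Q m v" if "m \<le> n" for m n v
    using that by (simp add: Qv[of m] blinfun.sum_right)
  then obtain L where
    L: "symmetric_op L" "L o\<^sub>L L = L" "\<And>v. (\<lambda>n. Q n v) \<longlonglongrightarrow> L v"
    using increasing_projections_converge[of Q] sym by blast
  have "C (L v) = L (C v)" if "C o\<^sub>L T = T o\<^sub>L C" for C v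
  proof -
    have "C (P i v) = P i (C v)" for i
      using rep that by (rule represents_commute)
    then have "C (Q n v) = Q n (C v)" for n by (simp add: Qv blinfun.sum_right)
    moreover have "(\<lambda>n. C (Q n v)) \<longlonglongrightarrow> C (L v)" by (intro blinfun.tendsto tendsto_const L)
    ultimately show "C (L v) = L (C v)" using L(3)[of "C v"] by (simp add: LIMSEQ_unique)
  qed
  moreover have "measure (mu v) (\<Union>i. A i) = L v \<bullet>\<^sub>R v" for v
  proof -
    interpret finite_measure "mu v" by (rule finite_measure_mu)
    have "(\<lambda>i. measure (mu v) (A i)) sums measure (mu v) (\<Union>i. A i)"
      using meas disj by (intro finite_measure_UNION) auto
    moreover have "(\<lambda>i. measure (mu v) (A i)) sums (L v \<bullet>\<^sub>R v)"
    proof -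
      have "(\<lambda>n. Q n v \<bullet>\<^sub>R v) \<longlonglongrightarrow> L v \<bullet>\<^sub>R v" by (intro rinner.tendsto tendsto_const L)
      moreover have "Q n v \<bullet>\<^sub>R v = (\<Sum>i<n. measure (mu v) (A i))" for n
        using rep by (simp add: Qv rinner.sum_left represents_def)
      ultimately show ?thesis by (simp add: sums_def)
    qed
    ultimately show ?thesis by (rule sums_unique2)
  qed
  moreover have "L (L v) = L v" for v using L(2) by (metis blinfun_apply_blinfun_compose)
  ultimately have "represents L (\<Union>i. A i)" using L(1) by (intro representsI)
  moreover have "(\<lambda>i. P i v) sums L v" for v using L(3)[of v] by (simp add: sums_def Qv)
  ultimately show ?thesis by blast
qed

lemma represents_Ioc:
  assumes "a \<le> b"
  shows "represents (F b - F a) {a<..b}"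
proof (rule representsI)
  show "symmetric_op (F b - F a)" by (intro symmetric_op_lincomb F_symmetric)
  show "(F b - F a) ((F b - F a) v) = (F b - F a) v" for v
    using assms by (simp add: blinfun.diff_left blinfun.diff_right F_F F_F_same)
  show "C ((F b - F a) v) = (F b - F a) (C v)" if "C o\<^sub>L T = T o\<^sub>L C" for C v
    using commute[OF that] by (simp add: blinfun_compose_eq_iff blinfun.diff_left blinfun.diff_right)
  show "measure (mu v) {a<..b} = (F b - F a) v \<bullet>\<^sub>R v" for v
    using assms by (simp add: measure_mu_Ioc dist_fun_def blinfun.diff_left rinner.diff_left)
qed

lemma represents_empty: "represents 0 {}"
  by (rule representsI) (simp_all add: symmetric_op_def rinner.zero_left rinner.zero_right blinfun.zero_right)

lemma represents_compl:
  assumes P: "represents P A" and A: "A \<in> sets borel"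
  shows "represents (id_blinfun - P) (- A)"
proof (rule representsI)
  show "symmetric_op (id_blinfun - P)"
    using P by (intro symmetric_op_lincomb) (simp add: represents_def)
  show "(id_blinfun - P) ((id_blinfun - P) v) = (id_blinfun - P) v" for v
    by (simp add: blinfun.diff_left blinfun.diff_right represents_idem[OF P])
  show "C ((id_blinfun - P) v) = (id_blinfun - P) (C v)" if "C o\<^sub>L T = T o\<^sub>L C" for C v
    by (simp add: blinfun.diff_left blinfun.diff_right represents_commute[OF P that])
  fix v
  interpret finite_measure "mu v" by (rule finite_measure_mu)
  have "measure (mu v) (UNIV - A) = measure (mu v) UNIV - measure (mu v) A"
    using A finite_measure_compl[of A] by simp
  moreover have "measure (mu v) A = P v \<bullet>\<^sub>R v" using P by (simp add: represents_def)
  ultimately show "measure (mu v) (- A) = (id_blinfun - P) v \<bullet>\<^sub>R v"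
    by (simp add: measure_mu_UNIV blinfun.diff_left rinner.diff_left rinner_self Compl_eq_Diff_UNIV)
qed

text \<open>Projections add up to a projection when they are orthogonal, which is why the induction
  is the one over disjoint unions; its intersection-stable generator is the half-open
  intervals.\<close>

lemma represents_exists:
  assumes "B \<in> sets borel"
  shows "\<exists>P. represents P B"
proof -
  let ?G = "range (\<lambda>(a, b). {a <.. b::real})"
  have borel: "sets borel = sigma_sets UNIV ?G" by (simp add: borel_sigma_sets_Ioc)
  have stable: "Int_stable ?G" by (auto simp: Int_stable_def)
  have "B \<in> sigma_sets UNIV ?G" using assms borel by simp
  from stable subset_UNIV[of ?G, folded Pow_UNIV] this show ?thesis
  proof (induction rule: sigma_sets_induct_disjoint)
    case (basic A)
    then obtain a b where "A = {a<..b}" by auto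
    then show ?case
      using represents_Ioc[of a b] represents_empty by (cases "a \<le> b") auto
  next
    case empty
    show ?case using represents_empty by blast
  next
    case (compl A)
    then show ?case using represents_compl[of _ A] by (auto simp: borel Compl_eq_Diff_UNIV)
  next
    case (union A)
    then show ?case using represents_countable_union[of _ A] by (metis borel)
  qed
qed

definition E :: "real set \<Rightarrow> 'h operator" where
  "E B = (SOME P. represents P B)"

lemma represents_E: "B \<in> sets borel \<Longrightarrow> represents (E B) B"
  unfolding E_def by (rule someI_ex) (rule represents_exists)

lemma E_eqI: "B \<in> sets borel \<Longrightarrow> represents P B \<Longrightarrow> E B = P"
  using represents_E represents_unique by blast

lemma E_add:
  assumes [measurable]: "A \<in> sets borel" "B \<in> sets borel" and "A \<inter> B = {}"
  shows "E (A \<union> B) v = E A v + E B v"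
proof -
  have "E (A \<union> B) = E A + E B"
  proof (rule symmetric_op_eqI)
    show "symmetric_op (E (A \<union> B))" "symmetric_op (E A + E B)"
      using represents_E[of A] represents_E[of B] represents_E[of "A \<union> B"]
      by (auto simp: represents_def intro!: symmetric_op_lincomb)
    fix v
    interpret finite_measure "mu v" by (rule finite_measure_mu)
    have "measure (mu v) (A \<union> B) = measure (mu v) A + measure (mu v) B"
      using assms by (intro finite_measure_Union) auto
    then show "E (A \<union> B) v \<bullet>\<^sub>R v = (E A + E B) v \<bullet>\<^sub>R v"
      using represents_E[of A] represents_E[of B] represents_E[of "A \<union> B"]
      by (simp add: represents_def blinfun.add_left rinner.add_left)
  qed
  then show ?thesis by (simp add: blinfun.add_left)
qed

text \<open>Both sets are split along their intersection; projections of disjoint pieces annihilate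
  each other, so one of the four products survives.\<close>

lemma E_Int:
  assumes [measurable]: "A \<in> sets borel" "B \<in> sets borel"
  shows "E (A \<inter> B) = E A o\<^sub>L E B"
proof (rule blinfun_eqI)
  fix v
  have split: "E C u = E (A \<inter> B) u + E (C - A \<inter> B) u" if "C = A \<or> C = B" for C u
    using that E_add[of "A \<inter> B" "C - A \<inter> B" u] by (auto simp: Un_absorb1)
  have disj: "E X (E Y u) = 0" if "X \<inter> Y = {}" "X \<in> sets borel" "Y \<in> sets borel" for X Y u
    using that by (intro represents_disjoint[OF represents_E represents_E]) auto
  have "E A (E B v) = E (A \<inter> B) (E (A \<inter> B) v)"
  proof -
    have "E (A - A \<inter> B) (E (A \<inter> B) v) = 0" "E (A - A \<inter> B) (E (B - A \<inter> B) v) = 0"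
      "E (A \<inter> B) (E (B - A \<inter> B) v) = 0"
      by (rule disj; auto)+
    then show ?thesis using split[of B v] split[of A] by (simp add: blinfun.add_right)
  qed
  then show "E (A \<inter> B) v = (E A o\<^sub>L E B) v"
    using represents_idem[OF represents_E, of "A \<inter> B"] by simp
qed

text \<open>\<open>G\<close> and \<open>H\<close> are the two sides truncated at \<open>t\<close>.
  On a step from \<open>s\<close> to \<open>t\<close> both increments lie between \<open>s\<close>
  and \<open>t\<close> times the increment of \<open>dist_fun v\<close>, so \<open>G - H\<close> is
  constant; it vanishes at \<open>- K\<close> and equals the difference of the two sides at
  \<open>K\<close>.\<close>

lemma T_form_eq_integral: "T v \<bullet>\<^sub>R v = (LINT t|mu v. t)"
proof -
  interpret finite_measure "mu v" by (rule finite_measure_mu)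
  \<comment> \<open>Strictly above \<open>norm T\<close>, so that \<open>F (- K)\<close> vanishes
    and the interval \<open>{- K<..K}\<close> has full mass.\<close>
  define K where "K = norm T + 1"
  have K: "norm T < K" "0 \<le> K" by (simp_all add: K_def)
  have nullK: "measure (mu v) (- {- K<..K}) = 0"
  proof -
    show ?thesis
      using measure_mu_support[OF K(1)] finite_measure_compl[of "{- K<..K}"] by (simp add: measure_mu_UNIV Compl_eq_Diff_UNIV)
  qed
  then have AE: "AE t in mu v. t \<in> {- K<..K}"
    by (intro AE_I[of _ _ "- {- K<..K}"]) (auto simp: emeasure_eq_measure)
  have int: "integrable (mu v) (\<lambda>t. t)"
  proof (rule integrable_const_bound[of _ K])
    show "AE t in mu v. norm t \<le> K" using AE by eventually_elim auto
  qed simp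
  have int_ind: "integrable (mu v) (\<lambda>t. indicator B t * t)" if "B \<in> sets borel" for B
    using integrable_mult_indicator[OF _ int, of B] that by simp
  define G where "G t = T (F t v) \<bullet>\<^sub>R v" for t
  define H where "H t = (LINT x|mu v. indicator {..t} x * x)" for t
  have "(G (- K) - H (- K)) = (G K - H K)"
  proof (rule vanishing_increment_quotient_imp_eq[where f = "dist_fun v" and D = "\<lambda>t. G t - H t"])
    fix s t :: real assume st: "s \<le> t"
    define w where "w = F t v - F s v"
    have w: "(norm w)\<^sup>2 = dist_fun v t - dist_fun v s" unfolding w_def by (rule norm_F_diff[OF st])
    have Tw: "T w \<bullet>\<^sub>R w = G t - G s"
    proof -
      have "F t w - F s w = w" using st by (simp add: w_def blinfun.diff_right F_F F_F_same)
      have "T w \<bullet>\<^sub>R w = T w \<bullet>\<^sub>R F t v - T w \<bullet>\<^sub>R F s v" by (simp add: w_def rinner.diff_right)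
      also have "\<dots> = T (F t w - F s w) \<bullet>\<^sub>R v"
        by (simp add: blinfun.diff_right rinner.diff_left F_T symmetric_opD[OF F_symmetric])
      also have "\<dots> = G t - G s"
        unfolding \<open>F t w - F s w = w\<close> by (simp add: w_def G_def blinfun.diff_right rinner.diff_left)
      finally show ?thesis .
    qed
    have "F t w = w" using st by (simp add: w_def blinfun.diff_right F_F F_F_same)
    then have up: "G t - G s \<le> t * (dist_fun v t - dist_fun v s)" using F_upper[of t w] by (simp add: Tw w)
    have "F s w = 0" using st by (simp add: w_def blinfun.diff_right F_F F_F_same)
    then have "s * (norm w)\<^sup>2 \<le> T w \<bullet>\<^sub>R w"
      using F_lower[of s w] by (cases "w = 0") (auto simp: rinner.zero_right)
    then have lo: "s * (dist_fun v t - dist_fun v s) \<le> G t - G s" by (simp add: Tw w)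
    have m: "measure (mu v) {s<..t} = dist_fun v t - dist_fun v s" by (rule measure_mu_Ioc[OF st])
    have "H t - H s = (LINT x|mu v. indicator {..t} x * x - indicator {..s} x * x)"
      unfolding H_def by (intro Bochner_Integration.integral_diff[symmetric] int_ind) auto
    also have "\<dots> = (LINT x|mu v. indicator {s<..t} x * x)"
      using st by (intro Bochner_Integration.integral_cong) (auto simp: indicator_def)
    finally have Hd: "H t - H s = (LINT x|mu v. indicator {s<..t} x * x)" .
    have c: "(LINT x|mu v. indicator {s<..t} x * c) = c * (dist_fun v t - dist_fun v s)" for c
      by (simp add: m)
    have ci: "integrable (mu v) (\<lambda>x. indicator {s<..t} x * c)" for c :: real
      by (intro integrable_mult_left integrable_real_indicator) (simp_all add: emeasure_eq_measure)
    have "(LINT x|mu v. indicator {s<..t} x * s) \<le> H t - H s"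
      unfolding Hd by (intro integral_mono int_ind ci) (auto simp: indicator_def)
    moreover have "H t - H s \<le> (LINT x|mu v. indicator {s<..t} x * t)"
      unfolding Hd by (intro integral_mono int_ind ci) (auto simp: indicator_def)
    ultimately show "\<bar>(G t - H t) - (G s - H s)\<bar> \<le> (t - s) * (dist_fun v t - dist_fun v s)"
      using up lo unfolding c by (simp add: algebra_simps abs_le_iff)
  qed (use K in simp)
  moreover have "G (- K) = 0" using K by (simp add: G_def F_low blinfun.zero_right rinner.zero_left)
  moreover have "G K = T v \<bullet>\<^sub>R v" using K by (simp add: G_def F_high)
  moreover have "H (- K) = (LINT x|mu v. 0)"
    unfolding H_def
  proof (rule integral_cong_AE)
    show "AE x in mu v. indicator {..- K} x * x = 0" using AE by eventually_elim (auto simp: indicator_def)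
  qed simp_all
  moreover have "H K = (LINT x|mu v. x)"
    unfolding H_def
  proof (rule integral_cong_AE)
    show "AE x in mu v. indicator {..K} x * x = x" using AE by eventually_elim (auto simp: indicator_def)
  qed simp_all
  ultimately show ?thesis by simp
qed

end

context spectral_family
begin

lemma scalar_measure_E: "scalar_measure E v = mu v"
proof -
  interpret finite_measure "mu v" by (rule finite_measure_mu)
  have "ennreal (Re (cinner (E B v) v)) = emeasure (mu v) B" if "B \<in> sigma_sets UNIV (sets borel)" for B
  proof -
    have "B \<in> sets borel" using that sets.sigma_sets_eq[of "borel :: real measure"] by simp
    from represents_E[OF this] show ?thesis
      by (simp add: emeasure_eq_measure represents_def rinner_def)
  qed
  then have "scalar_measure E v = measure_of UNIV (sets borel) (emeasure (mu v))"
    unfolding scalar_measure_def by (intro measure_of_eq) auto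
  also have "\<dots> = mu v" using measure_of_of_measure[of "mu v"] by simp
  finally show ?thesis .
qed

lemma represents_full:
  assumes "\<And>v. measure (mu v) B = (norm v)\<^sup>2"
  shows "represents id_blinfun B"
  using assms by (intro representsI symmetric_op_lincomb) (simp_all add: rinner_self)

lemma spectral_measure_of_E:
  assumes T: "T \<in> bounded_operators"
  shows "spectral_measure_of T E"
proof -
  have "projection_op (E B)" if "B \<in> sets borel" for B
    using represents_E[OF that] T
    by (auto simp: projection_op_def self_adjoint_iff represents_def bounded_operators_iff_commute)
  moreover have "E UNIV = id_blinfun"
    by (intro E_eqI represents_full measure_mu_UNIV) simp
  moreover have "(\<lambda>i::nat. E (A i) v) sums E (\<Union>i. A i) v"
    if A: "range A \<subseteq> sets borel" "disjoint_family A" for A v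
  proof -
    have "represents (E (A i)) (A i)" for i using A by (intro represents_E) auto
    from represents_countable_union[OF this A(2,1)] obtain L where
      L: "represents L (\<Union>i. A i)" "\<And>v. (\<lambda>i. E (A i) v) sums L v" by blast
    moreover have "(\<Union>i. A i) \<in> sets borel" using A by auto
    ultimately show ?thesis using E_eqI by metis
  qed
  ultimately have "projection_valued_measure E"
    by (simp add: projection_valued_measure_def E_Int)
  moreover have "E {- (norm T + 1)..norm T + 1} = id_blinfun"
  proof (intro E_eqI represents_full antisym)
    fix v
    interpret finite_measure "mu v" by (rule finite_measure_mu)
    show "measure (mu v) {- (norm T + 1)..norm T + 1} \<le> (norm v)\<^sup>2"
      unfolding measure_mu_UNIV[symmetric] by (rule finite_measure_mono) auto
    have "measure (mu v) {- (norm T + 1)<..norm T + 1} \<le> measure (mu v) {- (norm T + 1)..norm T + 1}"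
      by (rule finite_measure_mono) auto
    then show "(norm v)\<^sup>2 \<le> measure (mu v) {- (norm T + 1)..norm T + 1}"
      by (simp only: measure_mu_support less_add_one)
  qed simp
  moreover have "cinner (T v) v = complex_of_real (LINT t|scalar_measure E v. t)" for v
  proof -
    have "self_adjoint T" using T symmetric by (simp add: self_adjoint_iff)
    then show ?thesis by (simp add: self_adjoint_cinner scalar_measure_E T_form_eq_integral)
  qed
  ultimately show ?thesis unfolding spectral_measure_of_def by blast
qed

end

lemma spectral_family_exists:
  assumes "symmetric_op T"
  shows "\<exists>F. spectral_family T F"
proof -
  have "\<forall>t. \<exists>P. lower_spectral_projection T t P \<and> (\<forall>C. C o\<^sub>L T = T o\<^sub>L C \<longrightarrow> C o\<^sub>L P = P o\<^sub>L C)"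
    using lower_spectral_projection_exists[OF assms] by blast
  then obtain F where "\<And>t. lower_spectral_projection T t (F t)"
    "\<And>t C. C o\<^sub>L T = T o\<^sub>L C \<Longrightarrow> C o\<^sub>L F t = F t o\<^sub>L C" by metis
  then have "spectral_family T F" using assms by unfold_locales
  then show ?thesis by blast
qed

section \<open>Uniqueness of the spectral projections\<close>

locale pvm =
  fixes E :: "real set \<Rightarrow> 'h::complex_hilbert_space operator"
  assumes pvm: "projection_valued_measure E"
begin

lemma symmetric: "B \<in> sets borel \<Longrightarrow> symmetric_op (E B)"
  using pvm by (simp add: projection_valued_measure_def projection_op_def self_adjoint_iff)

lemma Int: "A \<in> sets borel \<Longrightarrow> B \<in> sets borel \<Longrightarrow> E A (E B v) = E (A \<inter> B) v"
  using pvm by (simp add: projection_valued_measure_def)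

lemma idem: "B \<in> sets borel \<Longrightarrow> E B (E B v) = E B v"
  by (simp add: Int)

lemma UNIV: "E UNIV v = v"
  using pvm by (simp add: projection_valued_measure_def)

lemma sums: "range A \<subseteq> sets borel \<Longrightarrow> disjoint_family A \<Longrightarrow> (\<lambda>i::nat. E (A i) v) sums E (\<Union>i. A i) v"
  using pvm by (simp add: projection_valued_measure_def)

text \<open>A constant series converges only if its term is 0.\<close>

lemma empty: "E {} v = 0"
proof -
  have "(\<lambda>i::nat. E {} v) sums E (\<Union>i::nat. {}) v"
    by (rule sums) (auto simp: disjoint_family_on_def)
  then have "summable (\<lambda>i::nat. E {} v)" by (rule sums_summable)
  then show ?thesis using summable_LIMSEQ_zero LIMSEQ_const_iff by blast
qed

lemma compl:
  assumes B: "B \<in> sets borel"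
  shows "E (- B) v = v - E B v"
proof -
  have "(\<lambda>i. E (binaryset B (- B) i) v) sums E (\<Union>i. binaryset B (- B) i) v"
    using B by (intro sums) (auto simp: range_binaryset_eq disjoint_family_on_def binaryset_def)
  moreover have "(\<lambda>i. E (binaryset B (- B) i) v) sums (E B v + E (- B) v)"
    using sums_finite[of "{..<2}" "\<lambda>i. E (binaryset B (- B) i) v"]
    by (simp add: binaryset_def empty numeral_2_eq_2)
  ultimately have "E B v + E (- B) v = v"
    using sums_unique2 by (fastforce simp: UN_binaryset_eq UNIV)
  then show ?thesis by (simp add: algebra_simps)
qed

lemma form: "B \<in> sets borel \<Longrightarrow> Re (cinner (E B v) v) = (norm (E B v))\<^sup>2"
  using symmetric_op_def[of "E B"] symmetric[of B] idem[of B v]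
  by (metis rinner_def rinner_self)

text \<open>\<open>measure_of\<close> takes the prescribed values only once countable additivity is
  verified; here it comes from strong additivity of \<open>E\<close>.\<close>

lemma emeasure_scalar:
  assumes "B \<in> sets borel"
  shows "emeasure (scalar_measure E v) B = ennreal ((norm (E B v))\<^sup>2)"
proof -
  have "emeasure (scalar_measure E v) B = ennreal (Re (cinner (E B v) v))"
    unfolding scalar_measure_def
  proof (rule emeasure_measure_of_sigma)
    show "sigma_algebra UNIV (sets (borel :: real measure))" using sets.sigma_algebra_axioms[of borel] by simp
    show "positive (sets borel) (\<lambda>B. ennreal (Re (cinner (E B v) v)))"
      by (simp add: positive_def empty rinner.zero_left[unfolded rinner_def])
    show "countably_additive (sets borel) (\<lambda>B. ennreal (Re (cinner (E B v) v)))"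
    proof (rule countably_additiveI)
      fix A :: "nat \<Rightarrow> real set"
      assume A: "range A \<subseteq> sets borel" "disjoint_family A" "(\<Union>i. A i) \<in> sets borel"
      have "(\<lambda>i. E (A i) v \<bullet>\<^sub>R v) sums (E (\<Union>i. A i) v \<bullet>\<^sub>R v)"
        by (rule bounded_linear.sums[OF rinner.bounded_linear_left sums[OF A(1,2)]])
      moreover have "0 \<le> E (A i) v \<bullet>\<^sub>R v" for i
        using form[of "A i" v] A(1) by (auto simp: rinner_def)
      ultimately show "(\<Sum>i. ennreal (Re (cinner (E (A i) v) v))) = ennreal (Re (cinner (E (\<Union>i. A i) v) v))"
        unfolding rinner_def by (intro suminf_ennreal_eq)
    qed
  qed (rule assms)
  then show ?thesis by (simp add: form assms)
qed

lemma sets_scalar [simp, measurable_cong]: "sets (scalar_measure E v) = sets borel"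
  using sets.sigma_sets_eq[of "borel :: real measure"] by (simp add: scalar_measure_def)

lemma space_scalar [simp]: "space (scalar_measure E v) = UNIV"
  by (simp add: scalar_measure_def space_measure_of_conv)

lemma finite_measure_scalar: "finite_measure (scalar_measure E v)"
  by (rule finite_measureI) (simp add: emeasure_scalar)

lemma measure_scalar: "B \<in> sets borel \<Longrightarrow> measure (scalar_measure E v) B = (norm (E B v))\<^sup>2"
  by (simp add: measure_def emeasure_scalar)

lemma scalar_measure_restrict:
  assumes [measurable]: "B \<in> sets borel"
  shows "scalar_measure E (E B v) = density (scalar_measure E v) (indicator B)"
proof (rule measure_eqI)
  fix A assume "A \<in> sets (scalar_measure E (E B v))"
  then have [measurable]: "A \<in> sets borel" by simp
  show "emeasure (scalar_measure E (E B v)) A = emeasure (density (scalar_measure E v) (indicator B)) A"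
    by (simp add: emeasure_scalar Int emeasure_density flip: indicator_inter_arith) (simp add: Int_commute emeasure_scalar)
qed simp

lemma AE_scalar:
  assumes [measurable]: "B \<in> sets borel" and "E B v = v"
  shows "AE t in scalar_measure E v. t \<in> B"
proof (rule AE_I)
  show "emeasure (scalar_measure E v) (- B) = 0"
    using assms by (simp add: emeasure_scalar compl)
qed auto

end

text \<open>Only the quadratic form of \<open>T\<close> is given as an integral. Splitting the
  integral over \<open>B\<close> and its complement shows that \<open>T\<close> has no cross terms
  between the two ranges, hence commutes with \<open>E B\<close>. The form bounds then follow from
  the support of the scalar measures.\<close>

lemma spectral_measure_lower_spectral_projection:
  assumes T: "self_adjoint T" and E: "spectral_measure_of T E"
  shows "lower_spectral_projection T t (E {..t})"
proof -
  interpret pvm E using E by unfold_locales (simp add: spectral_measure_of_def)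
  have symT: "symmetric_op T" using T by (simp add: self_adjoint_iff)
  obtain K where K: "E {-K..K} = id_blinfun" using E by (auto simp: spectral_measure_of_def)
  have form_T: "T v \<bullet>\<^sub>R v = (LINT t|scalar_measure E v. t)" for v
    using E by (simp add: spectral_measure_of_def rinner_def)
  have int: "integrable (scalar_measure E v) (\<lambda>t. t)" for v
  proof -
    interpret finite_measure "scalar_measure E v" by (rule finite_measure_scalar)
    have "AE t in scalar_measure E v. t \<in> {-K..K}" by (rule AE_scalar) (simp_all add: K)
    then have "AE t in scalar_measure E v. norm t \<le> K" by eventually_elim auto
    then show ?thesis by (rule integrable_const_bound) simp
  qed
  have commute: "T o\<^sub>L E B = E B o\<^sub>L T" if B[measurable]: "B \<in> sets borel" for B
  proof (rule commute_symmetric_projection[OF symmetric[OF B] symmetric_opD[OF symT]])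
    have restrict: "T (E A v) \<bullet>\<^sub>R E A v = (LINT t|scalar_measure E v. indicator A t * t)"
      if [measurable]: "A \<in> sets borel" for A v
    proof -
      have "(indicator A :: real \<Rightarrow> ennreal) = (\<lambda>t. ennreal (indicator A t))"
        by (auto simp: indicator_def)
      then show ?thesis
        unfolding form_T scalar_measure_restrict[OF that]
        using integral_density[of "\<lambda>t. t" "scalar_measure E v" "indicator A"] by simp
    qed
    have split: "T v \<bullet>\<^sub>R v = T (E B v) \<bullet>\<^sub>R E B v + T (E (- B) v) \<bullet>\<^sub>R E (- B) v" for v
    proof -
      have "T v \<bullet>\<^sub>R v = (LINT t|scalar_measure E v. indicator B t * t + indicator (- B) t * t)"
        unfolding form_T by (intro Bochner_Integration.integral_cong) (auto simp: indicator_def)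
      also have "\<dots> = (LINT t|scalar_measure E v. indicator B t * t) + (LINT t|scalar_measure E v. indicator (- B) t * t)"
        using integrable_mult_indicator[OF _ int[of v], of B] integrable_mult_indicator[OF _ int[of v], of "- B"]
        by (intro Bochner_Integration.integral_add) simp_all
      finally show ?thesis by (simp add: restrict)
    qed
    have orth: "T (E B a) \<bullet>\<^sub>R E (- B) b = 0" for a b
    proof -
      \<comment> \<open>A vector with one component from each range: comparing its expanded form
        with \<open>split\<close> isolates the cross term.\<close>
      define v where "v = E B a + E (- B) b"
      have "E B v = E B a" "E (- B) v = E (- B) b"
        by (simp_all add: v_def blinfun.add_right Int empty)
      then have "T v \<bullet>\<^sub>R v = T (E B a) \<bullet>\<^sub>R E B a + T (E (- B) b) \<bullet>\<^sub>R E (- B) b"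
        using split[of v] by (simp only:)
      then have "T (E B a) \<bullet>\<^sub>R E (- B) b + T (E (- B) b) \<bullet>\<^sub>R E B a = 0"
        by (simp add: v_def blinfun.add_right rinner.add_left rinner.add_right)
      moreover have "T (E (- B) b) \<bullet>\<^sub>R E B a = T (E B a) \<bullet>\<^sub>R E (- B) b"
        by (metis symmetric_opD[OF symT] rinner_commute)
      ultimately show ?thesis by simp
    qed
    show "E B (T (E B v)) = T (E B v)" for v
    proof -
      have "u \<bullet>\<^sub>R (T (E B v) - E B (T (E B v))) = u \<bullet>\<^sub>R 0" for u
        using orth[of v u] symmetric[of "- B"]
        by (simp add: symmetric_op_def rinner_commute[of "T (E B v)"] compl rinner.zero_right)
      then have "T (E B v) - E B (T (E B v)) = 0" by (rule rinner_eqI)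
      then show ?thesis by simp
    qed
    then show "E B (T (E B v)) = T (E B v)" for v .
  qed
  have upper: "T v \<bullet>\<^sub>R v \<le> t * (norm v)\<^sup>2" if v: "E {..t} v = v" for v
  proof -
    interpret finite_measure "scalar_measure E v" by (rule finite_measure_scalar)
    have "AE u in scalar_measure E v. u \<in> {..t}" by (rule AE_scalar[OF _ v]) simp
    then have "(LINT u|scalar_measure E v. u) \<le> (LINT u|scalar_measure E v. t)"
      by (intro integral_mono_AE int) auto
    then show ?thesis by (simp add: form_T measure_scalar UNIV mult.commute)
  qed
  have lower: "t * (norm v)\<^sup>2 < T v \<bullet>\<^sub>R v" if v: "E {..t} v = 0" "v \<noteq> 0" for v
  proof -
    interpret finite_measure "scalar_measure E v" by (rule finite_measure_scalar)
    have "AE u in scalar_measure E v. u \<in> - {..t}" by (rule AE_scalar) (simp_all add: compl v del: Compl_atMost)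
    then have AE: "AE u in scalar_measure E v. t < u" by eventually_elim auto
    have int': "integrable (scalar_measure E v) (\<lambda>u. u - t)" using int[of v] by simp
    have eq: "(LINT u|scalar_measure E v. u - t) = T v \<bullet>\<^sub>R v - t * (norm v)\<^sup>2"
      using int[of v] by (simp add: form_T measure_scalar UNIV mult.commute)
    have nonneg: "AE u in scalar_measure E v. 0 \<le> u - t" using AE by eventually_elim auto
    \<comment> \<open>Strictness: a zero integral of an almost everywhere positive function forces
      the zero measure, whereas the total mass is the squared norm of \<open>v\<close>.\<close>
    have "(LINT u|scalar_measure E v. u - t) \<noteq> 0"
    proof
      assume "(LINT u|scalar_measure E v. u - t) = 0"
      then have "AE u in scalar_measure E v. u - t = 0"
        using integral_nonneg_eq_0_iff_AE[OF int' nonneg] by blast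
      with AE have "AE u in scalar_measure E v. False" by eventually_elim auto
      then have "emeasure (scalar_measure E v) UNIV = 0" by (simp add: AE_iff_measurable[OF _ refl])
      then show False using v by (simp add: emeasure_scalar UNIV)
    qed
    moreover have "0 \<le> (LINT u|scalar_measure E v. u - t)" by (rule integral_nonneg_AE[OF nonneg])
    ultimately show ?thesis by (simp add: eq)
  qed
  have "E {..t} o\<^sub>L E {..t} = E {..t}" by (rule blinfun_eqI) (simp add: idem)
  then show ?thesis
    using symmetric[of "{..t}"] commute[of "{..t}"] upper lower by (simp add: lower_spectral_projection_def)
qed

text \<open>All spectral measures agree on half lines: \<open>E' {..t}\<close> commutes with
  \<open>T\<close>, hence with \<open>F t\<close>, and both are lower spectral projections at
  \<open>t\<close>. This resolves the definite description.\<close>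

lemma spectral_projection_half_lines:
  assumes T: "self_adjoint T"
  shows "lower_spectral_projection T t (spectral_projection {..t} T)"
    and "spectral_projection {t<..} T = id_blinfun - spectral_projection {..t} T"
    and "C o\<^sub>L T = T o\<^sub>L C \<Longrightarrow> C o\<^sub>L spectral_projection {..t} T = spectral_projection {..t} T o\<^sub>L C"
proof -
  have symT: "symmetric_op T" and bT: "T \<in> bounded_operators" using T by (simp_all add: self_adjoint_iff)
  obtain F where "spectral_family T F" using spectral_family_exists[OF symT] by blast
  then interpret spectral_family T F .
  have ex: "spectral_measure_of T E" by (rule spectral_measure_of_E[OF bT])
  have F: "E' {..t} = F t" if "spectral_measure_of T E'" for E'
  proof (rule lower_spectral_projection_unique[OF _ lower])
    show low: "lower_spectral_projection T t (E' {..t})"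
      by (rule spectral_measure_lower_spectral_projection[OF T that])
    show "E' {..t} o\<^sub>L F t = F t o\<^sub>L E' {..t}"
      using low by (intro commute) (simp add: lower_spectral_projection_def)
  qed
  then have 1: "spectral_projection {..t} T = F t"
    unfolding spectral_projection_def using ex by (intro the_equality) (metis, metis)
  have upper: "E' {t<..} = id_blinfun - F t" if E': "spectral_measure_of T E'" for E'
  proof -
    interpret E': pvm E' using E' by unfold_locales (simp add: spectral_measure_of_def)
    have "E' {t<..} v = v - E' {..t} v" for v
      using E'.compl[of "{..t}" v] by (simp add: Compl_atMost)
    then show ?thesis by (intro blinfun_eqI) (simp add: F[OF E'] blinfun.diff_left)
  qed
  have 2: "spectral_projection {t<..} T = id_blinfun - F t"
    unfolding spectral_projection_def using ex upper by (intro the_equality) (metis, metis)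
  show "lower_spectral_projection T t (spectral_projection {..t} T)"
    "spectral_projection {t<..} T = id_blinfun - spectral_projection {..t} T"
    "C o\<^sub>L T = T o\<^sub>L C \<Longrightarrow> C o\<^sub>L spectral_projection {..t} T = spectral_projection {..t} T o\<^sub>L C"
    using lower commute by (simp_all add: 1 2)
qed

section \<open>Von Neumann algebras and the Ottaviani inequality\<close>

text \<open>Turns the double commutant clause into a membership test, met by spectral projections
  through their commutation property.\<close>

lemma von_neumann_algebraI_mem:
  assumes "von_neumann_algebra N" "P \<in> bounded_operators"
    and "\<And>C. C \<in> commutant N \<Longrightarrow> P o\<^sub>L C = C o\<^sub>L P"
  shows "P \<in> N"
proof -
  have "P \<in> commutant (commutant N)" using assms(2,3) unfolding commutant_def[of "commutant N"] by blast
  then show ?thesis using assms(1) by (simp add: von_neumann_algebra_def)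
qed

lemma commutant_commute: "C \<in> commutant N \<Longrightarrow> a \<in> N \<Longrightarrow> C o\<^sub>L a = a o\<^sub>L C"
  by (simp add: commutant_def)

lemma von_neumann_algebra_bounded: "von_neumann_algebra N \<Longrightarrow> a \<in> N \<Longrightarrow> a \<in> bounded_operators"
  by (auto simp: von_neumann_algebra_def)

lemma von_neumann_algebra_closed:
  assumes N: "von_neumann_algebra N"
  shows "0 \<in> N" "id_blinfun \<in> N"
    and "a \<in> N \<Longrightarrow> b \<in> N \<Longrightarrow> a + b \<in> N"
    and "a \<in> N \<Longrightarrow> b \<in> N \<Longrightarrow> a - b \<in> N"
    and "a \<in> N \<Longrightarrow> b \<in> N \<Longrightarrow> a o\<^sub>L b \<in> N"
proof -
  note comm = commutant_commute[of _ N a] commutant_commute[of _ N b]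
  note bounded = von_neumann_algebra_bounded[OF N, of a] von_neumann_algebra_bounded[OF N, of b]
  show "0 \<in> N" "id_blinfun \<in> N"
    by (rule von_neumann_algebraI_mem[OF N];
        auto simp: bounded_operators_iff_commute blinfun_compose_eq_iff blinfun.zero_right)+
  show "a \<in> N \<Longrightarrow> b \<in> N \<Longrightarrow> a + b \<in> N" "a \<in> N \<Longrightarrow> b \<in> N \<Longrightarrow> a - b \<in> N"
    "a \<in> N \<Longrightarrow> b \<in> N \<Longrightarrow> a o\<^sub>L b \<in> N"
    using comm bounded by (auto intro!: von_neumann_algebraI_mem[OF N] simp: bounded_operators_iff_commute
        blinfun_compose_eq_iff blinfun.add_left blinfun.add_right blinfun.diff_left blinfun.diff_right)
qed

lemma von_neumann_algebra_sum:
  assumes N: "von_neumann_algebra N" and "\<And>i. i \<in> I \<Longrightarrow> x i \<in> N"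
  shows "sum x I \<in> N"
  using assms(2) by (induction I rule: infinite_finite_induct) (auto intro: von_neumann_algebra_closed[OF N])

lemma self_adjoint_sum:
  assumes "\<And>i. i \<in> I \<Longrightarrow> self_adjoint (x i)"
  shows "self_adjoint (sum x I)"
  using assms
proof (induction I rule: infinite_finite_induct)
  case (insert i I)
  then show ?case
    by (simp add: self_adjoint_iff symmetric_op_lincomb bounded_operators_iff_commute
        blinfun_compose.add_left blinfun_compose.add_right)
qed (simp_all add: self_adjoint_iff bounded_operators_iff_commute blinfun_compose_eq_iff
    blinfun.zero_right symmetric_op_def rinner.zero_left rinner.zero_right)

lemma self_adjoint_diff: "self_adjoint a \<Longrightarrow> self_adjoint b \<Longrightarrow> self_adjoint (a - b)"
  by (simp add: self_adjoint_iff symmetric_op_lincomb bounded_operators_iff_commute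
      blinfun_compose.diff_left blinfun_compose.diff_right)

section \<open>Spectral projections of absolute values\<close>

lemma self_adjoint_op_abs: "self_adjoint T \<Longrightarrow> self_adjoint (op_abs T)"
  using op_abs_of_self_adjoint(1) positive_op_iff by blast

lemma abs_spectral_projection_commute:
  assumes "self_adjoint T" "C o\<^sub>L T = T o\<^sub>L C"
  shows "C o\<^sub>L spectral_projection {..t} (op_abs T) = spectral_projection {..t} (op_abs T) o\<^sub>L C"
  using assms by (intro spectral_projection_half_lines(3) op_abs_of_self_adjoint(3) self_adjoint_op_abs)

text \<open>Commutation is transferred twice: \<open>T\<close> commutes with the projection of
  \<open>S\<close>, and that projection, as an operator commuting with \<open>T\<close>, commutes
  with the projection of \<open>T\<close>.\<close>

lemma abs_spectral_projections_commute:
  assumes S: "self_adjoint S" and T: "self_adjoint T" and ST: "S o\<^sub>L T = T o\<^sub>L S"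
  shows "spectral_projection {..s} (op_abs S) o\<^sub>L spectral_projection {..t} (op_abs T) =
    spectral_projection {..t} (op_abs T) o\<^sub>L spectral_projection {..s} (op_abs S)"
  using abs_spectral_projection_commute[OF S ST[symmetric], of s]
  by (intro abs_spectral_projection_commute[OF T]) simp

lemma abs_spectral_projection_lower:
  assumes "self_adjoint T"
  shows "lower_spectral_projection (op_abs T) t (spectral_projection {..t} (op_abs T))"
    and "spectral_projection {t<..} (op_abs T) = id_blinfun - spectral_projection {..t} (op_abs T)"
  by (rule spectral_projection_half_lines[OF self_adjoint_op_abs[OF assms]])+

lemma projection_op_abs_spectral_projection:
  assumes T: "self_adjoint T"
  shows "projection_op (spectral_projection {..t} (op_abs T))"
    and "projection_op (spectral_projection {t<..} (op_abs T))"
proof -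
  let ?X = "spectral_projection {..t} (op_abs T)"
  have X: "symmetric_op ?X" "?X o\<^sub>L ?X = ?X"
    using abs_spectral_projection_lower(1)[OF T, of t] by (simp_all add: lower_spectral_projection_def)
  have "?X \<in> bounded_operators"
    unfolding bounded_operators_iff_commute
    using T by (intro allI abs_spectral_projection_commute) (simp_all add: self_adjoint_iff bounded_operators_iff_commute)
  then show 1: "projection_op ?X" using X by (simp add: projection_op_def self_adjoint_iff)
  have "?X (?X v) = ?X v" for v using X(2) by (metis blinfun_apply_blinfun_compose)
  then show "projection_op (spectral_projection {t<..} (op_abs T))"
    using X(1) \<open>?X \<in> bounded_operators\<close> unfolding abs_spectral_projection_lower(2)[OF T]
    by (auto simp: projection_op_def self_adjoint_iff symmetric_op_lincomb bounded_operators_iff_commute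
        blinfun_compose_eq_iff blinfun.diff_left blinfun.diff_right intro!: blinfun_eqI)
qed

lemma abs_spectral_projection_mem:
  assumes N: "von_neumann_algebra N" and T: "self_adjoint T" "T \<in> N"
  shows "spectral_projection {..t} (op_abs T) \<in> N" "spectral_projection {t<..} (op_abs T) \<in> N"
proof -
  show 1: "spectral_projection {..t} (op_abs T) \<in> N"
  proof (rule von_neumann_algebraI_mem[OF N])
    show "spectral_projection {..t} (op_abs T) \<in> bounded_operators"
      using projection_op_abs_spectral_projection(1)[OF T(1)] by (simp add: projection_op_def self_adjoint_iff)
    show "spectral_projection {..t} (op_abs T) o\<^sub>L C = C o\<^sub>L spectral_projection {..t} (op_abs T)"
      if "C \<in> commutant N" for C
      using abs_spectral_projection_commute[OF T(1) commutant_commute[OF that T(2)]] by simp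
  qed
  show "spectral_projection {t<..} (op_abs T) \<in> N"
    unfolding abs_spectral_projection_lower(2)[OF T(1)]
    by (intro von_neumann_algebra_closed[OF N] 1)
qed

text \<open>The range of the projection is invariant under \<open>op_abs T\<close>, so the form
  bound holds at both vectors from which a norm bound can be drawn.\<close>

lemma norm_le_on_lower_spectral_subspace:
  assumes T: "self_adjoint T" and v: "spectral_projection {..t} (op_abs T) v = v" and "0 \<le> t"
  shows "norm (T v) \<le> t * norm v"
proof -
  let ?A = "op_abs T" and ?X = "spectral_projection {..t} (op_abs T)"
  have X: "lower_spectral_projection ?A t ?X" by (rule abs_spectral_projection_lower[OF T])
  then have comm: "?A o\<^sub>L ?X = ?X o\<^sub>L ?A"
    and upper: "?X w = w \<Longrightarrow> ?A w \<bullet>\<^sub>R w \<le> t * (norm w)\<^sup>2" for w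
    by (simp_all add: lower_spectral_projection_def)
  have "?X (?A v) = ?A v" using comm v by (metis blinfun_apply_blinfun_compose)
  then have "norm (?A v) \<le> t * norm v"
    using op_abs_of_self_adjoint(1)[OF T] v \<open>0 \<le> t\<close> upper
    by (intro norm_le_of_positive_form_le) (auto simp: positive_op_iff self_adjoint_iff)
  then show ?thesis by (simp add: norm_op_abs[OF T])
qed

lemma norm_gt_on_upper_spectral_subspace:
  assumes T: "self_adjoint T" and v: "spectral_projection {..t} (op_abs T) v = 0" "v \<noteq> 0"
  shows "t * norm v < norm (T v)"
proof -
  have "t * (norm v)\<^sup>2 < op_abs T v \<bullet>\<^sub>R v"
    using abs_spectral_projection_lower(1)[OF T, of t] v by (simp add: lower_spectral_projection_def)
  also have "\<dots> \<le> norm (op_abs T v) * norm v" using rinner_Cauchy_Schwarz abs_le_D1 by blast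
  finally show ?thesis using v by (simp add: norm_op_abs[OF T] power2_eq_square flip: mult.assoc)
qed

text \<open>Commutation lets a single vector \<open>w\<close> lie in the ranges of \<open>P\<close>,
  \<open>Q\<close> and the complement of \<open>G\<close>. Then \<open>a w\<close> is longer than
  \<open>\<alpha>\<close> allows, while \<open>b w\<close> and \<open>(b - a) w\<close> are short,
  against the triangle inequality.\<close>

lemma commuting_spectral_projections_le:
  fixes a b :: "'h::complex_hilbert_space operator"
  assumes a: "self_adjoint a" and b: "self_adjoint b" and comm: "a o\<^sub>L b = b o\<^sub>L a"
    and "0 \<le> \<beta>" "0 \<le> \<gamma>" "\<beta> + \<gamma> \<le> \<alpha>"
  defines "P \<equiv> spectral_projection {\<alpha><..} (op_abs a)"
    and "Q \<equiv> spectral_projection {..\<beta>} (op_abs (b - a))"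
    and "G \<equiv> spectral_projection {\<gamma><..} (op_abs b)"
  shows "P o\<^sub>L Q = Q o\<^sub>L P" "(P o\<^sub>L Q) o\<^sub>L G = P o\<^sub>L Q" "G o\<^sub>L (P o\<^sub>L Q) = P o\<^sub>L Q"
proof -
  have d: "self_adjoint (b - a)" by (rule self_adjoint_diff[OF b a])
  define P' where "P' = spectral_projection {..\<alpha>} (op_abs a)"
  define G' where "G' = spectral_projection {..\<gamma>} (op_abs b)"
  have P: "P = id_blinfun - P'" and G: "G = id_blinfun - G'"
    unfolding P_def P'_def G_def G'_def by (intro abs_spectral_projection_lower a b)+
  have "P' o\<^sub>L Q = Q o\<^sub>L P'" "P' o\<^sub>L G' = G' o\<^sub>L P'" "Q o\<^sub>L G' = G' o\<^sub>L Q"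
    unfolding P'_def Q_def G'_def
    by (rule abs_spectral_projections_commute;
        use a b d comm in \<open>simp add: blinfun_compose.diff_left blinfun_compose.diff_right\<close>)+
  then have c: "P' (Q v) = Q (P' v)" "P' (G' v) = G' (P' v)" "Q (G' v) = G' (Q v)" for v
    by (simp_all add: blinfun_compose_eq_iff)
  have "projection_op P'" "projection_op Q" "projection_op G'"
    unfolding P'_def Q_def G'_def by (intro projection_op_abs_spectral_projection a b d)+
  then have i: "P' (P' v) = P' v" "Q (Q v) = Q v" "G' (G' v) = G' v" for v
    by (metis blinfun_apply_blinfun_compose projection_op_def)+
  have zero: "P (Q (G' u)) = 0" for u
  proof (rule ccontr)
    define w where "w = P (Q (G' u))"
    assume "P (Q (G' u)) \<noteq> 0"
    then have w: "w \<noteq> 0" by (simp add: w_def)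
    have "P' w = 0" by (simp add: w_def P blinfun.diff_left blinfun.diff_right i)
    then have "\<alpha> * norm w < norm (a w)"
      unfolding P'_def using w by (rule norm_gt_on_upper_spectral_subspace[OF a])
    also have "a w = b w - (b - a) w" by (simp add: blinfun.diff_left)
    also have "norm \<dots> \<le> norm (b w) + norm ((b - a) w)" by (rule norm_triangle_ineq4)
    also have "G' w = w" by (simp add: w_def P blinfun.diff_left blinfun.diff_right i c)
    then have "norm (b w) \<le> \<gamma> * norm w"
      unfolding G'_def using \<open>0 \<le> \<gamma>\<close> by (rule norm_le_on_lower_spectral_subspace[OF b])
    also have "Q w = w" by (simp add: w_def P blinfun.diff_left blinfun.diff_right i c)
    then have "norm ((b - a) w) \<le> \<beta> * norm w"
      unfolding Q_def using \<open>0 \<le> \<beta>\<close> by (rule norm_le_on_lower_spectral_subspace[OF d])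
    finally have "\<alpha> * norm w < (\<gamma> + \<beta>) * norm w" by (simp add: algebra_simps)
    also have "\<dots> \<le> \<alpha> * norm w" using assms by (intro mult_right_mono) simp_all
    finally show False by simp
  qed
  show "P o\<^sub>L Q = Q o\<^sub>L P" by (simp add: P blinfun_compose_eq_iff blinfun.diff_left blinfun.diff_right c)
  show "(P o\<^sub>L Q) o\<^sub>L G = P o\<^sub>L Q" by (rule blinfun_eqI) (simp add: G blinfun.diff_left blinfun.diff_right zero)
  have "G' (P (Q v)) = 0" for v
    using zero[of v] by (simp add: P blinfun.diff_left blinfun.diff_right c)
  then show "G o\<^sub>L (P o\<^sub>L Q) = P o\<^sub>L Q" by (intro blinfun_eqI) (simp add: G blinfun.diff_left)
qed

section \<open>Order of projections under a state\<close>

lemma projection_op_positive: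
  assumes "projection_op P"
  shows "positive_op P"
proof -
  have "P v \<bullet>\<^sub>R v = (norm (P v))\<^sup>2" for v
    using assms by (intro symmetric_idempotent_form) (simp_all add: projection_op_def self_adjoint_iff)
  then show ?thesis using assms by (simp add: positive_op_iff projection_op_def)
qed

lemma projection_op_compose:
  assumes "projection_op P" "projection_op Q" "P o\<^sub>L Q = Q o\<^sub>L P"
  shows "projection_op (P o\<^sub>L Q)"
proof -
  have "P (P v) = P v" "Q (Q v) = Q v" "P (Q v) = Q (P v)" for v
    using assms by (metis blinfun_apply_blinfun_compose projection_op_def)+
  then show ?thesis
    using assms symmetric_op_compose[of P Q]
    by (auto simp: projection_op_def self_adjoint_iff bounded_operators_iff_commute blinfun_compose_eq_iff
        intro!: blinfun_eqI)
qed

lemma projection_op_diff: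
  assumes "projection_op G" "projection_op R" "R o\<^sub>L G = R" "G o\<^sub>L R = R"
  shows "projection_op (G - R)"
proof -
  have "G (G v) = G v" "R (R v) = R v" "R (G v) = R v" "G (R v) = R v" for v
    using assms by (metis blinfun_apply_blinfun_compose projection_op_def)+
  then have "(G - R) o\<^sub>L (G - R) = G - R"
    by (intro blinfun_eqI) (simp add: blinfun.diff_left blinfun.diff_right)
  then show ?thesis using assms by (simp add: projection_op_def self_adjoint_diff)
qed

lemma state_projection:
  assumes "state_on M \<tau>" "projection_op P" "P \<in> M"
  shows "0 \<le> Re (\<tau> P)" "\<tau> P = complex_of_real (Re (\<tau> P))"
proof -
  have "\<tau> P \<in> \<real>\<^sub>\<ge>\<^sub>0" using assms projection_op_positive[OF assms(2)] unfolding state_on_def by blast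
  then show "0 \<le> Re (\<tau> P)" "\<tau> P = complex_of_real (Re (\<tau> P))"
    by (auto simp: complex_nonneg_Reals_iff complex_eq_iff)
qed

lemma state_projection_mono:
  assumes M: "von_neumann_algebra M" and \<tau>: "state_on M \<tau>" and G: "projection_op G" "G \<in> M"
    and R: "projection_op R" "R \<in> M" and le: "R o\<^sub>L G = R" "G o\<^sub>L R = R"
  shows "Re (\<tau> R) \<le> Re (\<tau> G)"
proof -
  have "G - R \<in> M" using M G R by (intro von_neumann_algebra_closed)
  moreover have "0 \<le> Re (\<tau> (G - R))"
    using state_projection(1)[OF \<tau> projection_op_diff[OF G(1) R(1) le]] calculation by blast
  moreover have "\<tau> ((G - R) + R) = \<tau> (G - R) + \<tau> R"
    using \<tau> R calculation(1) unfolding state_on_def by blast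
  ultimately show ?thesis by simp
qed

text \<open>Covers the last index, where \<open>s n - s n = 0\<close>.\<close>

lemma spectral_projection_abs_zero:
  assumes "0 \<le> t"
  shows "spectral_projection {..t} (op_abs (0 :: 'h::complex_hilbert_space operator)) = id_blinfun"
proof (rule blinfun_eqI, rule ccontr)
  let ?X = "spectral_projection {..t} (op_abs (0 :: 'h operator))"
  have z: "self_adjoint (0 :: 'h operator)" using self_adjoint_sum[of "{}"] by simp
  fix v assume "?X v \<noteq> id_blinfun v"
  then have "v - ?X v \<noteq> 0" by simp
  moreover have "?X (?X v) = ?X v"
    using projection_op_abs_spectral_projection(1)[OF z, of t]
    by (metis blinfun_apply_blinfun_compose projection_op_def)
  then have "?X (v - ?X v) = 0" by (simp add: blinfun.diff_right)
  ultimately have "t * norm (v - ?X v) < norm ((0 :: 'h operator) (v - ?X v))"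
    by (intro norm_gt_on_upper_spectral_subspace[OF z])
  then show False using mult_nonneg_nonneg[OF assms norm_ge_zero[of "v - ?X v"]] by simp
qed

theorem theorem2p7:
  fixes M :: "'h::complex_hilbert_space operator set"
    and \<tau> :: "'h operator \<Rightarrow> complex"
    and x s :: "nat \<Rightarrow> 'h operator"
    and n :: nat and lam :: real and M_lam :: ereal
  assumes "von_neumann_algebra M"
    and "normal_faithful_tracial_state M \<tau>"
    and "1 \<le> n"
    and "weakly_fully_independent M \<tau> x n"
    and "\<And>k. k \<in> {1..n} \<Longrightarrow> self_adjoint (x k)"
    and "\<And>k. s k = (\<Sum>i=1..k. x i)"
    and "\<And>k. k \<in> {1..n} \<Longrightarrow> s k o\<^sub>L s n = s n o\<^sub>L s k"
    and "lam > 0"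
    and "M_lam = 1 / ereal (MIN k\<in>{1..n}.
           Re (\<tau> (spectral_projection {..lam / 2} (op_abs (s n - s k)))))"
  shows "\<exists>p\<in>M. projection_op p \<and>
           (MAX k\<in>{1..n}. 1 / 2 ^ (k - 1) *
              Re (\<tau> (spectral_projection {2 * lam<..} (op_abs (s k))))) \<le> Re (\<tau> p) \<and>
           (M_lam = \<infinity> \<or>
            ereal (Re (\<tau> p)) \<le>
              M_lam * ereal (Re (\<tau> (spectral_projection {lam / 2<..} (op_abs (s n))))))"
proof -
  define P where "P k = spectral_projection {2 * lam<..} (op_abs (s k))" for k
  define Q where "Q k = spectral_projection {..lam / 2} (op_abs (s n - s k))" for k
  define G where "G = spectral_projection {lam / 2<..} (op_abs (s n))"
  note M = assms(1)
  have \<tau>: "state_on M \<tau>" using assms(2) by (simp add: normal_faithful_tracial_state_def)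
  have sa: "self_adjoint (s k)" if "k \<in> {1..n}" for k
    unfolding assms(6) using that by (intro self_adjoint_sum assms(5)) auto
  have n: "n \<in> {1..n}" using assms(3) by simp
  have s_mem: "s k \<in> M" if "k \<in> {1..n}" for k
    unfolding assms(6) using that assms(4)
    by (intro von_neumann_algebra_sum[OF M]) (auto simp: weakly_fully_independent_def)
  have sad: "self_adjoint (s n - s k)" if "k \<in> {1..n}" for k
    by (intro self_adjoint_diff sa n that)
  have d_mem: "s n - s k \<in> M" if "k \<in> {1..n}" for k
    by (intro von_neumann_algebra_closed[OF M] s_mem n that)
  have proj: "projection_op (P k)" "projection_op (Q k)" and mem: "P k \<in> M" "Q k \<in> M"
    if "k \<in> {1..n}" for k
    unfolding P_def Q_def
    by (rule projection_op_abs_spectral_projection abs_spectral_projection_mem[OF M];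
        rule sa sad s_mem d_mem; rule that)+
  have projG: "projection_op G" and memG: "G \<in> M"
    unfolding G_def
    by (rule projection_op_abs_spectral_projection abs_spectral_projection_mem[OF M];
        rule sa s_mem; rule n)+
  have indep: "\<tau> (P k o\<^sub>L Q k) = \<tau> (P k) * \<tau> (Q k)" if k: "k \<in> {1..n}" for k
  proof (cases "k = n")
    \<comment> \<open>For \<open>k = n\<close> the second block of variables is empty and the cut
      \<open>Suc k\<close> exceeds \<open>n\<close>, so factorisation is checked directly with
      \<open>Q n\<close> the identity.\<close>
    case True
    then have "Q k = id_blinfun" using assms(8) by (simp add: Q_def spectral_projection_abs_zero)
    moreover have "\<tau> id_blinfun = 1" using \<tau> by (simp add: state_on_def)
    moreover have "P k o\<^sub>L id_blinfun = P k" by (rule blinfun_eqI) simp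
    ultimately show ?thesis by simp
  next
    case False
    have "{1..n} = {1..k} \<union> {Suc k..n}" using k by auto
    then have "s n = s k + (\<Sum>i\<in>{Suc k..n}. x i)"
      unfolding assms(6) by (simp add: sum.union_disjoint)
    then have diff: "s n - s k = (\<Sum>i\<in>{Suc k..n}. x i)" by simp
    have "P k \<in> W_star (x ` {1..<Suc k})"
      unfolding W_star_def P_def
    proof safe
      fix N assume "von_neumann_algebra N" "x ` {1..<Suc k} \<subseteq> N"
      then show "spectral_projection {2 * lam<..} (op_abs (s k)) \<in> N"
        using k by (intro abs_spectral_projection_mem sa) (auto simp: assms(6) intro!: von_neumann_algebra_sum)
    qed
    moreover have "Q k \<in> W_star (x ` {Suc k..n})"
      unfolding W_star_def Q_def
    proof safe
      fix N assume "von_neumann_algebra N" "x ` {Suc k..n} \<subseteq> N"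
      then show "spectral_projection {..lam / 2} (op_abs (s n - s k)) \<in> N"
        using k by (intro abs_spectral_projection_mem sad) (auto simp: diff intro!: von_neumann_algebra_sum)
    qed
    moreover have "1 < Suc k \<and> Suc k \<le> n" using k False by auto
    ultimately show ?thesis using assms(4) unfolding weakly_fully_independent_def by blast
  qed
  have key: "Re (\<tau> (P k)) * Re (\<tau> (Q k)) \<le> Re (\<tau> G)" if k: "k \<in> {1..n}" for k
  proof -
    \<comment> \<open>\<open>\<beta>\<close> and \<open>\<gamma>\<close> are both
      \<open>lam / 2\<close>, and \<open>\<alpha>\<close> is \<open>2 * lam\<close>.\<close>
    have "0 \<le> lam / 2" "lam / 2 + lam / 2 \<le> 2 * lam" using assms(8) by simp_all
    note le = commuting_spectral_projections_le[OF sa[OF k] sa[OF n] assms(7)[OF k] this(1,1,2),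
        folded P_def Q_def G_def]
    have "Re (\<tau> (P k o\<^sub>L Q k)) \<le> Re (\<tau> G)"
      using k by (intro state_projection_mono[OF M \<tau> projG memG _ _ le(2,3)] projection_op_compose proj le(1)
          von_neumann_algebra_closed[OF M] mem)
    moreover have "\<tau> (P k o\<^sub>L Q k) = complex_of_real (Re (\<tau> (P k)) * Re (\<tau> (Q k)))"
      using indep[OF k] state_projection(2)[OF \<tau> proj(1) mem(1), OF k k]
        state_projection(2)[OF \<tau> proj(2) mem(2), OF k k] by (metis of_real_mult)
    ultimately show ?thesis by simp
  qed
  have "Max ((\<lambda>k. Re (\<tau> (P k))) ` {1..n}) \<in> (\<lambda>k. Re (\<tau> (P k))) ` {1..n}"
    using assms(3) by (intro Max_in) auto
  then obtain j where j: "j \<in> {1..n}" and "Re (\<tau> (P j)) = Max ((\<lambda>k. Re (\<tau> (P k))) ` {1..n})"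
    by auto
  then have max: "Re (\<tau> (P k)) \<le> Re (\<tau> (P j))" if "k \<in> {1..n}" for k
    using that by simp
  have P_nonneg: "0 \<le> Re (\<tau> (P k))" if "k \<in> {1..n}" for k
    using state_projection(1)[OF \<tau>] proj mem that by blast
  have "(MAX k\<in>{1..n}. 1 / 2 ^ (k - 1) * Re (\<tau> (P k))) \<le> Re (\<tau> (P j))"
  proof (rule Max.boundedI)
    fix y assume "y \<in> (\<lambda>k. 1 / 2 ^ (k - 1) * Re (\<tau> (P k))) ` {1..n}"
    then obtain k where k: "k \<in> {1..n}" and y: "y = 1 / 2 ^ (k - 1) * Re (\<tau> (P k))" by blast
    have "y \<le> 1 * Re (\<tau> (P k))" unfolding y using P_nonneg[OF k] by (intro mult_right_mono) simp_all
    then show "y \<le> Re (\<tau> (P j))" using max[OF k] by simp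
  qed (use assms(3) in auto)
  moreover have "M_lam = \<infinity> \<or> ereal (Re (\<tau> (P j))) \<le> M_lam * ereal (Re (\<tau> G))"
  proof -
    define m where "m = (MIN k\<in>{1..n}. Re (\<tau> (Q k)))"
    have m_le: "m \<le> Re (\<tau> (Q j))" unfolding m_def using j by simp
    have m0: "0 \<le> m" unfolding m_def
      using assms(3) state_projection(1)[OF \<tau>] proj mem by (intro Min.boundedI) auto
    have M_lam: "M_lam = 1 / ereal m" using assms(9) by (simp add: m_def Q_def)
    show ?thesis
    proof (cases "m = 0")
      case True
      \<comment> \<open>\<open>1 / 0\<close> is \<open>\<infinity>\<close> in \<open>ereal\<close>,
        so the first disjunct holds; the convention \<open>\<infinity> * 0 = 0\<close> stays out of
        the bound.\<close>
      then show ?thesis by (simp add: M_lam divide_ereal_def)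
    next
      case False
      have "Re (\<tau> (P j)) * m \<le> Re (\<tau> (P j)) * Re (\<tau> (Q j))"
        using m_le P_nonneg[OF j] by (rule mult_left_mono)
      also have "\<dots> \<le> Re (\<tau> G)" by (rule key[OF j])
      finally have "Re (\<tau> (P j)) \<le> 1 / m * Re (\<tau> G)" using False m0 by (simp add: field_simps)
      then show ?thesis using False by (simp add: M_lam one_ereal_def)
    qed
  qed
  ultimately show ?thesis
    using proj(1)[OF j] mem(1)[OF j] unfolding P_def G_def by blast
qed

end
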